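(* For almost all $\bm{a}\in\Omega$ one has $\lambda(\mathcal{A}(\bm{a}))=1$. In fact, for every fixed $c\in\,]0,\tfrac12]$ and for almost all $\bm{a}=(a_p)_p\in\Omega$, there exists a set $S\subset[0,1]$ of Lebesgue measure $1$ such that for all $x\in S$, all $\varepsilon>0$ and all $X\geq 3$, $$|\{p\leq X \text{ prime} : |x-a_p/p|\leq c/p\}| = 2c\log\log X+O\bigl((\log\log X)^{1/2+\varepsilon}\bigr),$$ where the implied constant does not depend on $X$ (it may depend on $c,\bm{a},x,\varepsilon$).
   Context: The index $p$ always runs over prime numbers. $\Omega=\{(a_p)_p : a_p\in\mathbf{Z},\ 0\leq a_p<p \text{ for all primes } p\}$, endowed with the product probability measure for which the coordinates $a_p$ are independent and each $a_p$ is uniformly distributed in $\{0,\ldots,p-1\}$; "almost all $\bm{a}\in\Omega$" refers to this measure. $\lambda$ is Lebesgue measure on $[0,1]$. For $\bm{a}=(a_p)_p\in\Omega$, $$\mathcal{A}(\bm{a})=\{x\in[0,1] : \liminf_{p\to\infty} p\,|x-a_p/p|=0\}.$$ *)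

theory Defs
  imports "HOL-Probability.Probability" "HOL-Computational_Algebra.Primes"
begin

text \<open>
  The index set is the set of primes; the elements of the product space are total functions that
  are \<^const>\<open>undefined\<close> off the primes, and only their values at primes are ever used.
\<close>

definition Omega :: "(nat \<Rightarrow> int) measure" where
  "Omega = (\<Pi>\<^sub>M p\<in>{p. prime p}. uniform_count_measure {0..<int p})"

lemma space_Omega: "space Omega = (\<Pi>\<^sub>E p\<in>{p. prime p}. {0..<int p})"
  by (simp add: Omega_def space_PiM space_uniform_count_measure)

lemma prob_space_Omega: "prob_space Omega"
  unfolding Omega_def
proof (rule prob_space_PiM)
  fix p :: nat
  assume "p \<in> {p. prime p}"
  then have "0 < p" by (simp add: prime_gt_0_nat)
  then show "prob_space (uniform_count_measure {0..<int p})"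
    by (intro prob_space_uniform_count_measure) auto
qed

text \<open>The filter describing \<open>p \<rightarrow> \<infinity>\<close> along the primes.\<close>

definition primes_at_top :: "nat filter" where
  "primes_at_top = inf at_top (principal {p. prime p})"

definition calA :: "(nat \<Rightarrow> int) \<Rightarrow> real set" where
  "calA a =
    {x \<in> {0..1}. Liminf primes_at_top (\<lambda>p. ereal (real p * \<bar>x - real_of_int (a p) / real p\<bar>)) = 0}"

abbreviation lambda01 :: "real measure" where
  "lambda01 \<equiv> lebesgue_on {0..1}"

end

theory Submission
  imports Defs "HOL-Real_Asymp.Real_Asymp"
begin

text \<open>
  On the product of \<^const>\<open>Omega\<close> and the unit interval, the event that \<open>x\<close> is within
  \<open>c / p\<close> of \<open>a\<^sub>p / p\<close> has probability \<open>2c/p + O(1/p\<^sup>2)\<close>. For primes \<open>p < q\<close>, an interval of radius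
  \<open>c / p\<close> meets at most \<open>2cq/p + 2c + 1\<close> intervals of radius \<open>c / q\<close>, so the covariance of the two events
  is \<open>O(1/q\<^sup>2 + 1/(p\<^sup>2q))\<close>. Hence the number of hits among any finite set of primes \<open>B\<close> has variance
  \<open>O(\<Sum>p\<in>B. 1/p)\<close>. By Mertens' theorem, stopping the count at \<open>exp (exp j)\<close> gives a process whose
  increments have second moment \<open>O(j - i)\<close>, and the dyadic chaining argument of Rademacher and Menshov
  yields the almost sure bound \<open>O(j\<^bsup>1/2+\<epsilon>\<^esup>)\<close> for its centered version. Monotonicity of the count
  fills the gaps between the points \<open>exp (exp j)\<close>, and Fubini's theorem separates \<open>a\<close> from \<open>x\<close>.
  The assertion on \<^const>\<open>calA\<close> follows by letting \<open>c\<close> tend to \<open>0\<close> through a sequence.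
\<close>

section \<open>Mertens' theorems\<close>

lemma card_multiples:
  fixes d n :: nat
  assumes "d > 0"
  shows "card {m \<in> {1..n}. d dvd m} = n div d"
proof -
  have "{m \<in> {1..n}. d dvd m} = (\<lambda>k. d * k) ` {1..n div d}"
  proof (rule set_eqI)
    fix m
    show "m \<in> {m \<in> {1..n}. d dvd m} \<longleftrightarrow> m \<in> (\<lambda>k. d * k) ` {1..n div d}"
      using assms by (auto simp: image_iff less_eq_div_iff_mult_less_eq mult.commute elim!: dvdE)
  qed
  moreover have "inj_on (\<lambda>k. d * k) {1..n div d}"
    using assms by (auto simp: inj_on_def)
  ultimately show ?thesis by (simp add: card_image)
qed

lemma ln_eq_sum_multiplicity:
  fixes n :: nat
  assumes "n > 0"
  shows "ln (real n) = (\<Sum>p\<in>prime_factors n. real (multiplicity p n) * ln (real p))"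
proof -
  have "(\<Prod>p\<in>prime_factors n. p ^ multiplicity p n) = n"
    using prod_prime_factors[of n] assms by simp
  then have "real n = real (\<Prod>p\<in>prime_factors n. p ^ multiplicity p n)"
    by (rule arg_cong[OF sym])
  also have "\<dots> = (\<Prod>p\<in>prime_factors n. real p ^ multiplicity p n)"
    by (simp only: of_nat_prod of_nat_power)
  also have "ln \<dots> = (\<Sum>p\<in>prime_factors n. ln (real p ^ multiplicity p n))"
    by (rule ln_prod) (auto simp: in_prime_factors_iff prime_gt_0_nat)
  also have "\<dots> = (\<Sum>p\<in>prime_factors n. real (multiplicity p n) * ln (real p))"
    by (intro sum.cong refl ln_realpow)
  finally show ?thesis .
qed

lemma sum_ln_primes_le:
  fixes n :: nat
  assumes "n > 0" "finite P" "\<And>p. p \<in> P \<Longrightarrow> prime p \<and> p dvd n"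
  shows "(\<Sum>p\<in>P. ln (real p)) \<le> ln (real n)"
proof -
  have "(\<Sum>p\<in>P. ln (real p)) \<le> (\<Sum>p\<in>P. real (multiplicity p n) * ln (real p))"
  proof (rule sum_mono)
    fix p assume "p \<in> P"
    then have p: "prime p" "p dvd n" using assms by auto
    then have "multiplicity p n \<ge> 1"
      using assms(1) by (simp add: Suc_le_eq prime_multiplicity_gt_zero_iff)
    moreover have "ln (real p) \<ge> 0" using p prime_ge_1_nat by simp
    ultimately show "ln (real p) \<le> real (multiplicity p n) * ln (real p)"
      by (intro mult_right_mono[of 1 "real (multiplicity p n)" "ln (real p)", simplified]) auto
  qed
  also have "\<dots> \<le> (\<Sum>p\<in>prime_factors n. real (multiplicity p n) * ln (real p))"
    using assms by (intro sum_mono2) (auto simp: in_prime_factors_iff prime_ge_1_nat)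
  finally show ?thesis using ln_eq_sum_multiplicity[OF assms(1)] by simp
qed

text \<open>Chebyshev's bound by induction: for \<open>n = 2 * m + 1\<close> every prime in
  \<open>(m + 1, n]\<close> divides \<open>n choose m\<close>, which is at most
  \<open>2 ^ n\<close>, and the primes up to \<open>m + 1\<close> are covered by the induction
  hypothesis. An even \<open>n > 2\<close> is not prime and adds nothing.\<close>

lemma theta_le: "(\<Sum>p | prime p \<and> p \<le> n. ln (real p)) \<le> 3 * real n"
proof (induction n rule: less_induct)
  case (less n)
  have "n \<le> 1 \<or> n = 2 \<or> n > 2" by linarith
  then consider "n \<le> 1" | "n = 2" | "n > 2" "even n" | "n > 2" "odd n" by blast
  then show ?case
  proof cases
    case 1
    then have "{p. prime p \<and> p \<le> n} = {}" by (auto dest: prime_ge_2_nat)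
    then show ?thesis by (simp only: sum.empty)
  next
    case 2
    have "{p. prime p \<and> p \<le> (2::nat)} = {2}"
      by (auto dest: prime_ge_2_nat)
    then show ?thesis using 2 ln_2_less_1 by simp
  next
    case 3
    have "\<not> prime n" using 3 primes_dvd_imp_eq two_is_prime_nat by blast
    then have "{p. prime p \<and> p \<le> n} = {p. prime p \<and> p \<le> n - 1}"
      by (auto simp: le_eq_less_or_eq)
    then show ?thesis using less[of "n - 1"] 3 by simp
  next
    case 4
    then obtain m where m: "n = 2 * m + 1" "m \<ge> 1" by (auto elim!: oddE)
    let ?P = "{p. prime p \<and> m + 1 < p \<and> p \<le> n}"
    have fin: "finite ?P" by (rule finite_subset[of _ "{..n}"]) auto
    have dvd: "p dvd (n choose m)" if "p \<in> ?P" for p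
    proof -
      have p: "prime p" "m + 1 < p" "p \<le> n" using that by auto
      have "p dvd fact n" using p by (simp only: prime_dvd_fact_iff)
      moreover have "fact m * fact (n - m) * (n choose m) = fact n"
        by (rule binomial_fact_lemma) (use m in simp)
      ultimately have "p dvd fact m * fact (n - m) * (n choose m)" by (simp only:)
      \<comment> \<open>Since \<open>n - m = m + 1 < p\<close>, neither factorial can absorb the
        factor \<open>p\<close> of \<open>fact n\<close>.\<close>
      moreover have "\<not> p dvd fact m" "\<not> p dvd fact (n - m)"
        using p by (simp_all only: prime_dvd_fact_iff) (use p m in auto)
      ultimately show ?thesis using p by (auto simp: m(1) prime_dvd_mult_iff simp del: binomial_Suc_Suc fact_Suc)
    qed
    have eq: "{p. prime p \<and> p \<le> n} = {p. prime p \<and> p \<le> m + 1} \<union> ?P" using m by auto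
    have "(\<Sum>p | prime p \<and> p \<le> n. ln (real p)) =
      (\<Sum>p | prime p \<and> p \<le> m + 1. ln (real p)) + (\<Sum>p\<in>?P. ln (real p))"
      unfolding eq using fin by (intro sum.union_disjoint) auto
    also have "\<dots> \<le> 3 * real (m + 1) + ln (real (n choose m))"
      using less[of "m + 1"] m dvd fin
      by (intro add_mono sum_ln_primes_le) (auto simp del: binomial_Suc_Suc)
    also have "ln (real (n choose m)) \<le> ln (real (2 ^ n))"
    proof -
      have "n choose m > 0" using m by (simp del: binomial_Suc_Suc)
      then show ?thesis using binomial_le_pow2[of n m] by (metis ln_le_cancel_iff of_nat_0_less_iff of_nat_le_iff zero_less_numeral zero_less_power)
    qed
    also have "ln (real (2 ^ n)) = real n * ln 2" by (simp add: ln_realpow)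
    \<comment> \<open>The total \<open>3 * (m + 1) + (2 * m + 1)\<close> is at most
      \<open>3 * (2 * m + 1)\<close> because \<open>m \<ge> 1\<close>.\<close>
    also have "real n * ln 2 \<le> real n" using ln_2_less_1 by (simp add: mult_left_le)
    finally show ?thesis using m by simp
  qed
qed

text \<open>Legendre's formula: the pairs \<open>(m, k)\<close> with \<open>p ^ k\<close> dividing
  \<open>m\<close> are counted in both orders.\<close>

lemma sum_multiplicity_eq:
  fixes p n :: nat
  assumes "prime p"
  shows "(\<Sum>m=1..n. multiplicity p m) = (\<Sum>k=1..n. n div p ^ k)"
proof -
  have *: "multiplicity p m = (\<Sum>k=1..n. if p ^ k dvd m then 1 else 0)" if "m \<in> {1..n}" for m
  proof -
    \<comment> \<open>Cutting the exponents off at \<open>n\<close> loses nothing, since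
      \<open>multiplicity p m < p ^ multiplicity p m \<le> m\<close>.\<close>
    have "multiplicity p m < 2 ^ multiplicity p m" by (rule less_exp)
    also have "\<dots> \<le> p ^ multiplicity p m"
      using prime_ge_2_nat[OF assms] by (rule power_mono) simp
    also have "\<dots> \<le> m" using that by (intro dvd_imp_le multiplicity_dvd) simp
    finally have "multiplicity p m \<le> n" using that by simp
    then have "{k \<in> {1..n}. p ^ k dvd m} = {1..multiplicity p m}"
      using that assms prime_ge_2_nat[OF assms]
      by (auto simp: power_dvd_iff_le_multiplicity[of m p])
    then show ?thesis by (simp add: sum.If_cases Int_def)
  qed
  have "(\<Sum>m=1..n. multiplicity p m) = (\<Sum>m=1..n. \<Sum>k=1..n. if p ^ k dvd m then 1 else 0)"
    by (intro sum.cong refl *)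
  also have "\<dots> = (\<Sum>k=1..n. \<Sum>m=1..n. if p ^ k dvd m then 1 else 0)"
    by (rule sum.swap)
  also have "\<dots> = (\<Sum>k=1..n. card {m \<in> {1..n}. p ^ k dvd m})"
    by (intro sum.cong refl) (simp add: sum.If_cases Int_def)
  also have "\<dots> = (\<Sum>k=1..n. n div p ^ k)"
    using assms by (intro sum.cong refl card_multiples) (simp add: prime_gt_0_nat)
  finally show ?thesis .
qed

lemma ln_fact_eq:
  "ln (fact n :: real) =
    (\<Sum>p | prime p \<and> p \<le> n. real (\<Sum>k=1..n. n div p ^ k) * ln (real p))"
proof -
  let ?P = "{p. prime p \<and> p \<le> n}"
  have *: "ln (real m) = (\<Sum>p\<in>?P. real (multiplicity p m) * ln (real p))" if "m \<in> {1..n}" for m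
  proof -
    have "prime_factors m \<subseteq> ?P"
    proof
      fix p assume "p \<in> prime_factors m"
      then have "prime p" "p dvd m" by auto
      moreover from this have "p \<le> m" using that by (intro dvd_imp_le) auto
      ultimately show "p \<in> ?P" using that by simp
    qed
    then have "(\<Sum>p\<in>prime_factors m. real (multiplicity p m) * ln (real p)) =
        (\<Sum>p\<in>?P. real (multiplicity p m) * ln (real p))"
      using that by (intro sum.mono_neutral_left) (auto simp: prime_factors_multiplicity)
    then show ?thesis using ln_eq_sum_multiplicity[of m] that by simp
  qed
  have "ln (fact n :: real) = (\<Sum>m=1..n. ln (real m))"
    unfolding fact_prod of_nat_prod by (rule ln_prod) auto
  also have "\<dots> = (\<Sum>m=1..n. \<Sum>p\<in>?P. real (multiplicity p m) * ln (real p))"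
    by (intro sum.cong refl *)
  also have "\<dots> = (\<Sum>p\<in>?P. \<Sum>m=1..n. real (multiplicity p m) * ln (real p))"
    by (rule sum.swap)
  also have "\<dots> = (\<Sum>p\<in>?P. real (\<Sum>m=1..n. multiplicity p m) * ln (real p))"
    by (simp only: of_nat_sum sum_distrib_right)
  also have "\<dots> = (\<Sum>p\<in>?P. real (\<Sum>k=1..n. n div p ^ k) * ln (real p))"
    by (intro sum.cong refl) (simp only: sum_multiplicity_eq mem_Collect_eq)
  finally show ?thesis .
qed

text \<open>Weak Stirling bound; the induction step is \<open>ln (1 + 1 / n) \<le> 1 / n\<close>
  multiplied by \<open>n\<close>.\<close>

lemma ln_fact_ge: "real n * ln (real n) - real n \<le> ln (fact n)"
proof (induction n)
  case (Suc n)
  show ?case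
  proof (cases "n = 0")
    case False
    have "real (Suc n) = real n * (1 + 1 / real n)" using False by (simp add: field_simps)
    then have "ln (real (Suc n)) = ln (real n * (1 + 1 / real n))" by (simp only:)
    also have "\<dots> = ln (real n) + ln (1 + 1 / real n)"
      using False by (intro ln_mult_pos) (auto intro: add_pos_nonneg)
    also have "ln (1 + 1 / real n) \<le> 1 / real n" using False by (intro ln_add_one_self_le_self) simp
    finally have "real n * (ln (real (Suc n)) - ln (real n)) \<le> 1"
      using False by (simp add: field_simps)
    moreover have "ln (fact (Suc n) :: real) = ln (real (Suc n)) + ln (fact n)"
      by (simp add: ln_mult flip: of_nat_Suc)
    ultimately show ?thesis using Suc by (simp add: algebra_simps)
  qed simp
qed simp

lemma ln_fact_le: "ln (fact n) \<le> real n * ln (real n)"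
proof (cases "n = 0")
  case False
  have "ln (fact n :: real) \<le> ln (real n ^ n)"
    using fact_le_power[of n, where ?'a = real] False by (subst ln_le_cancel_iff) auto
  then show ?thesis by (simp add: ln_realpow)
qed simp

lemma sum_inverse_powers_le:
  fixes p :: real
  assumes "p > 1"
  shows "(\<Sum>k=1..n. 1 / p ^ k) \<le> 1 / (p - 1)"
proof -
  have "(\<Sum>k=1..n. 1 / p ^ k) = (1 - 1 / p ^ n) / (p - 1)"
  proof (induction n)
    case (Suc n)
    have "(\<Sum>k=1..Suc n. 1 / p ^ k) = (1 - 1 / p ^ n) / (p - 1) + 1 / p ^ Suc n"
      using Suc by simp
    also have "\<dots> = (1 - 1 / p ^ Suc n) / (p - 1)"
      using assms by (simp add: divide_simps) (simp add: algebra_simps)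
    finally show ?case .
  qed simp
  also have "\<dots> \<le> 1 / (p - 1)" using assms by (intro divide_right_mono) auto
  finally show ?thesis .
qed

text \<open>\<open>1 / (p * (p - 1))\<close> is the sum of \<open>1 / p ^ k\<close> over
  \<open>k \<ge> 2\<close>, so this series bounds what higher prime powers contribute to
  \<open>ln (fact n) / n\<close>.\<close>

lemma summable_ln_over_square: "summable (\<lambda>n. ln (real n) / (real n * (real n - 1)))"
proof (rule summable_comparison_test_bigo)
  show "summable (\<lambda>n. norm (real n powr (- (3/2))))"
    by (simp add: summable_real_powr_iff)
  show "(\<lambda>n. ln (real n) / (real n * (real n - 1))) \<in> O(\<lambda>n. real n powr (- (3/2)))"
    by real_asymp
qed

text \<open>Both bounds compare the expansion \<open>ln_fact_eq\<close> with
  \<open>ln (fact n) = n * ln n + O(n)\<close> and divide by \<open>n\<close>.\<close>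

theorem mertens_first:
  obtains C where "\<And>n. n \<ge> 1 \<Longrightarrow>
    \<bar>(\<Sum>p | prime p \<and> p \<le> n. ln (real p) / real p) - ln (real n)\<bar> \<le> C"
proof
  define K where "K = (\<Sum>n. ln (real n) / (real n * (real n - 1)))"
  fix n :: nat assume n: "n \<ge> 1"
  let ?P = "{p. prime p \<and> p \<le> n}"
  let ?S = "\<Sum>p\<in>?P. ln (real p) / real p"
  have p1: "real p > 1" if "p \<in> ?P" for p using that prime_gt_1_nat by simp
  \<comment> \<open>Upper bound: only \<open>k = 1\<close> matters in the sum over \<open>k\<close>,
    and each floor costs \<open>ln p\<close>, in total at most \<open>3 * n\<close> by Chebyshev's
    bound.\<close>
  have "real n * ?S \<le> (\<Sum>p\<in>?P. real (\<Sum>k=1..n. n div p ^ k) * ln (real p)) + (\<Sum>p\<in>?P. ln (real p))"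
    unfolding sum_distrib_left sum.distrib[symmetric]
  proof (rule sum_mono)
    fix p assume p: "p \<in> ?P"
    have "n div p ^ 1 \<le> (\<Sum>k=1..n. n div p ^ k)" using n by (intro member_le_sum) auto
    then have "real (n div p) \<le> real (\<Sum>k=1..n. n div p ^ k)"
      by (simp only: of_nat_le_iff power_one_right)
    moreover have "real n / real p \<le> real (n div p) + 1"
      using floor_divide_of_nat_eq[of n p, where ?'a = real] by linarith
    ultimately have "real n / real p \<le> real (\<Sum>k=1..n. n div p ^ k) + 1" by linarith
    then have "real n / real p * ln (real p) \<le> (real (\<Sum>k=1..n. n div p ^ k) + 1) * ln (real p)"
      using p1[OF p] by (intro mult_right_mono) auto
    then show "real n * (ln (real p) / real p) \<le> real (\<Sum>k=1..n. n div p ^ k) * ln (real p) + ln (real p)"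
      by (simp add: algebra_simps)
  qed
  also have "\<dots> \<le> real n * ln (real n) + 3 * real n"
    using ln_fact_eq[of n] ln_fact_le[of n] theta_le[of n] by linarith
  also have "\<dots> = real n * (ln (real n) + 3)" by (simp add: algebra_simps)
  finally have upper: "?S \<le> ln (real n) + 3" using n by simp
  \<comment> \<open>Lower bound: all floors are dropped, and the geometric series gives
    \<open>1 / (p - 1) = 1 / p + 1 / (p * (p - 1))\<close>, whose second part, weighted by
    \<open>ln p\<close>, sums to at most \<open>K\<close>.\<close>
  have "(\<Sum>p\<in>?P. real (\<Sum>k=1..n. n div p ^ k) * ln (real p)) \<le>
      (\<Sum>p\<in>?P. real n * (ln (real p) / real p + ln (real p) / (real p * (real p - 1))))"
  proof (rule sum_mono)
    fix p assume p: "p \<in> ?P"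
    have "real (\<Sum>k=1..n. n div p ^ k) \<le> (\<Sum>k=1..n. real n * (1 / real p ^ k))"
      unfolding of_nat_sum
    proof (rule sum_mono)
      fix k
      have "real (n div p ^ k) \<le> real n / real (p ^ k)"
        using floor_divide_of_nat_eq[of n "p ^ k", where ?'a = real] by linarith
      then show "real (n div p ^ k) \<le> real n * (1 / real p ^ k)" by simp
    qed
    also have "\<dots> \<le> real n * (1 / (real p - 1))"
      unfolding sum_distrib_left[symmetric] using p1[OF p]
      by (intro mult_left_mono sum_inverse_powers_le) auto
    finally have "real (\<Sum>k=1..n. n div p ^ k) * ln (real p) \<le> real n * (1 / (real p - 1)) * ln (real p)"
      using p1[OF p] by (intro mult_right_mono) auto
    also have "\<dots> = real n * (ln (real p) / real p + ln (real p) / (real p * (real p - 1)))"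
      using p1[OF p] by (simp add: divide_simps) (simp add: algebra_simps)
    finally show "real (\<Sum>k=1..n. n div p ^ k) * ln (real p) \<le>
      real n * (ln (real p) / real p + ln (real p) / (real p * (real p - 1)))" .
  qed
  also have "\<dots> = real n * (?S + (\<Sum>p\<in>?P. ln (real p) / (real p * (real p - 1))))"
    by (simp only: sum_distrib_left[symmetric] sum.distrib)
  also have "(\<Sum>p\<in>?P. ln (real p) / (real p * (real p - 1))) \<le> K"
    unfolding K_def
  proof (rule sum_le_suminf[OF summable_ln_over_square])
    show "0 \<le> ln (real m) / (real m * (real m - 1))" for m
      by (cases "m = 0") auto
  qed auto
  finally have "ln (fact n) \<le> real n * (?S + K)"
    unfolding ln_fact_eq by (simp add: mult_left_mono)
  with ln_fact_ge[of n] have "real n * (ln (real n) - 1) \<le> real n * (?S + K)"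
    by (simp add: algebra_simps)
  then have lower: "ln (real n) - 1 \<le> ?S + K" using n by simp
  have "K \<ge> 0" unfolding K_def
  proof (rule suminf_nonneg[OF summable_ln_over_square])
    show "0 \<le> ln (real m) / (real m * (real m - 1))" for m
      by (cases "m = 0") auto
  qed
  with upper lower show "\<bar>?S - ln (real n)\<bar> \<le> 3 + K" by linarith
qed

section \<open>Partial summation and Mertens' second theorem\<close>

text \<open>Abel's inequality. It carries the bounded error of Mertens' first theorem over to sums
  weighted by \<open>1 / ln k\<close>.\<close>

lemma abs_sum_mult_antimono_le:
  fixes d g :: "nat \<Rightarrow> real"
  assumes bound: "\<And>n. n \<ge> m \<Longrightarrow> \<bar>\<Sum>k=m..n. d k\<bar> \<le> B"
    and anti: "\<And>k. k \<ge> m \<Longrightarrow> g (Suc k) \<le> g k" and nonneg: "\<And>k. k \<ge> m \<Longrightarrow> 0 \<le> g k"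
    and "m \<le> n"
  shows "\<bar>\<Sum>k=m..n. d k * g k\<bar> \<le> B * g m"
proof -
  define S where "S n = (\<Sum>k=m..n. d k)" for n
  \<comment> \<open>summation by parts, with the last term \<open>S n * g n\<close> moved to the left\<close>
  have "\<bar>(\<Sum>k=m..n. d k * g k) - S n * g n\<bar> \<le> B * (g m - g n)"
    using \<open>m \<le> n\<close>
  proof (induction n rule: nat_induct_at_least)
    case base
    then show ?case by (simp add: S_def)
  next
    case (Suc n)
    have "(\<Sum>k=m..Suc n. d k * g k) - S (Suc n) * g (Suc n) =
      ((\<Sum>k=m..n. d k * g k) - S n * g n) + S n * (g n - g (Suc n))"
      using Suc by (simp add: S_def algebra_simps)
    also have "\<bar>\<dots>\<bar> \<le> B * (g m - g n) + B * (g n - g (Suc n))"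
    proof -
      have "\<bar>S n * (g n - g (Suc n))\<bar> \<le> B * (g n - g (Suc n))"
        using bound[of n] anti[of n] Suc unfolding S_def abs_mult
        by (intro mult_mono) auto
      then show ?thesis using Suc.IH by linarith
    qed
    finally show ?case by (simp add: algebra_simps)
  qed
  moreover have "\<bar>S n * g n\<bar> \<le> B * g n"
    using bound[of n] nonneg[of n] \<open>m \<le> n\<close> unfolding S_def abs_mult by (intro mult_mono) auto
  ultimately have "\<bar>\<Sum>k=m..n. d k * g k\<bar> \<le> B * (g m - g n) + B * g n" by linarith
  then show ?thesis by (simp add: algebra_simps)
qed

lemma ln_diff_le: "0 < (y::real) \<Longrightarrow> 0 < x \<Longrightarrow> ln x - ln y \<le> (x - y) / y"
  using ln_le_minus_one[of "x / y"] by (simp add: ln_div diff_divide_distrib)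

lemma ln_ge_half: "x \<ge> 2 \<Longrightarrow> ln x \<ge> (1 / 2 :: real)"
  using ln_diff_le[of x 1] ln_diff_le[of x 2] ln_diff_le[of 2 1] ln_le_cancel_iff[of 2 x] ln2_ge_two_thirds
  by linarith

text \<open>A Riemann sum for the integral of \<open>1 / u\<close> in the variable
  \<open>u = ln t\<close>, taken at right endpoints. The constant \<open>1 - ln (ln 2)\<close> makes
  the error vanish at \<open>n = 2\<close>; the errors of the single steps are dominated by a
  telescoping series.\<close>

lemma sum_ln_diff_over_ln:
  assumes "n \<ge> 2"
  shows "\<bar>(\<Sum>k=2..n. (ln (real k) - ln (real (k - 1))) / ln (real k)) - ln (ln (real n)) - (1 - ln (ln 2))\<bar>
    \<le> 4 * (1 - 1 / (real n - 1))"
  using assms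
proof (induction n rule: nat_induct_at_least)
  case base
  then show ?case by simp
next
  case (Suc n)
  define L where "L = ln (real (Suc n))"
  define l where "l = ln (real n)"
  have half: "l \<ge> 1 / 2" "L \<ge> 1 / 2" unfolding l_def L_def by (rule ln_ge_half; use Suc in simp)+
  have L: "L - l \<le> 1 / real n" "l \<le> L"
    using ln_diff_le[of "real n" "real (Suc n)"] Suc unfolding L_def l_def by auto
  have 1: "ln L - ln l \<ge> (L - l) / L"
    using ln_diff_le[of L l] half by (simp add: field_simps)
  \<comment> \<open>The increment \<open>ln L - ln l\<close> lies between \<open>(L - l) / L\<close>
    and \<open>(L - l) / l\<close>; as both \<open>l\<close> and \<open>L\<close> are at least
    \<open>1 / 2\<close>, these differ by at most \<open>4 / n ^ 2\<close>.\<close>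
  have "ln L - ln l - (L - l) / L \<le> (L - l) / l - (L - l) / L"
    using ln_diff_le[of l L] half by simp
  also have "\<dots> = (L - l) * (L - l) * ((1 / l) * (1 / L))"
    using half by (simp add: field_simps)
  also have "\<dots> \<le> (1 / real n) * (1 / real n) * (2 * 2)"
    using half L by (intro mult_mono) (auto simp: field_simps)
  also have "\<dots> \<le> 4 * (1 / (real n - 1) - 1 / real n)"
    using Suc by (simp add: divide_simps)
  finally have 2: "ln L - ln l - (L - l) / L \<le> 4 * (1 / (real n - 1) - 1 / real n)" .
  have "(\<Sum>k=2..Suc n. (ln (real k) - ln (real (k - 1))) / ln (real k)) =
    (\<Sum>k=2..n. (ln (real k) - ln (real (k - 1))) / ln (real k)) + (L - l) / L"
    using Suc by (simp add: L_def l_def)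
  with Suc.IH 1 2 show ?case unfolding L_def[symmetric] l_def[symmetric] by simp
qed

lemma mertens_second_nat:
  obtains C where "\<And>n. n \<ge> 2 \<Longrightarrow>
    \<bar>(\<Sum>p | prime p \<and> p \<le> n. 1 / real p) - ln (ln (real n))\<bar> \<le> C"
proof -
  obtain C where C: "\<And>n. n \<ge> 1 \<Longrightarrow>
    \<bar>(\<Sum>p | prime p \<and> p \<le> n. ln (real p) / real p) - ln (real n)\<bar> \<le> C"
    by (rule mertens_first) blast
  define a where "a k = (if prime k then ln (real k) / real k else 0)" for k :: nat
  \<comment> \<open>\<open>b\<close> is the smooth model of \<open>a\<close>: it telescopes to
    \<open>ln n\<close>, so by Mertens' first theorem \<open>a - b\<close> has bounded partial
    sums.\<close>
  define b where "b k = ln (real k) - ln (real (k - 1))" for k :: nat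
  have primes: "{p. prime p \<and> p \<le> n} = {k \<in> {2..n}. prime k}" for n :: nat
    by (auto dest: prime_ge_2_nat)
  have suma: "(\<Sum>p | prime p \<and> p \<le> n. f p) = (\<Sum>k=2..n. if prime k then f k else 0)"
    for n and f :: "nat \<Rightarrow> real"
    unfolding primes by (simp add: sum.If_cases Int_def)
  have sumb: "(\<Sum>k=2..n. b k) = ln (real n)" if "n \<ge> 2" for n
    using that by (induction n rule: nat_induct_at_least) (auto simp: b_def)
  have "\<bar>\<Sum>k=2..n. a k - b k\<bar> \<le> C" if "n \<ge> 2" for n
    using C[of n] that unfolding suma sum_subtractf sumb[OF that] by (simp add: a_def)
  then have D: "\<bar>\<Sum>k=2..n. (a k - b k) * (1 / ln (real k))\<bar> \<le> C * (1 / ln (real 2))" if "n \<ge> 2" for n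
    using that by (intro abs_sum_mult_antimono_le) (auto simp: frac_le)
  have "\<bar>(\<Sum>p | prime p \<and> p \<le> n. 1 / real p) - ln (ln (real n))\<bar>
      \<le> C * (1 / ln (real 2)) + (4 + \<bar>1 - ln (ln 2)\<bar>)" if n: "n \<ge> 2" for n
  proof -
    have "(\<Sum>p | prime p \<and> p \<le> n. 1 / real p) = (\<Sum>k=2..n. a k * (1 / ln (real k)))"
      unfolding suma by (intro sum.cong refl) (auto simp: a_def)
    then have "(\<Sum>k=2..n. (a k - b k) * (1 / ln (real k))) =
      (\<Sum>p | prime p \<and> p \<le> n. 1 / real p) - (\<Sum>k=2..n. (ln (real k) - ln (real (k - 1))) / ln (real k))"
      by (simp add: b_def left_diff_distrib diff_divide_distrib sum_subtractf)
    moreover have "4 * (1 - 1 / (real n - 1)) \<le> 4" using n by simp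
    ultimately show ?thesis
      using D[OF n] sum_ln_diff_over_ln[OF n] by linarith
  qed
  then show thesis by (rule that)
qed

theorem mertens_second:
  obtains C where "\<And>x. x \<ge> 2 \<Longrightarrow>
    \<bar>(\<Sum>p | prime p \<and> real p \<le> x. 1 / real p) - ln (ln x)\<bar> \<le> C"
proof -
  obtain C where C: "\<And>n. n \<ge> 2 \<Longrightarrow>
    \<bar>(\<Sum>p | prime p \<and> p \<le> n. 1 / real p) - ln (ln (real n))\<bar> \<le> C"
    by (rule mertens_second_nat) blast
  have "\<bar>(\<Sum>p | prime p \<and> real p \<le> x. 1 / real p) - ln (ln x)\<bar> \<le> C + 1" if x: "x \<ge> 2" for x
  proof -
    define n where "n = nat \<lfloor>x\<rfloor>"
    have n: "n \<ge> 2" "real n \<le> x" "x \<le> real n + 1"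
      using x unfolding n_def by linarith+
    have "{p. prime p \<and> real p \<le> x} = {p. prime p \<and> p \<le> n}"
      unfolding n_def using x by (auto simp: le_nat_floor le_floor_iff nat_le_iff le_nat_iff)
    moreover have "ln (ln (real n)) \<le> ln (ln x)" using n x by simp
    \<comment> \<open>Rounding \<open>x\<close> down moves \<open>ln x\<close> by at most
      \<open>1 / 2\<close>, and dividing by \<open>ln n \<ge> 1 / 2\<close> gives 1.\<close>
    moreover have "ln (ln x) - ln (ln (real n)) \<le> 1"
    proof -
      have half: "ln (real n) \<ge> 1 / 2" using n by (intro ln_ge_half) simp
      have "ln x - ln (real n) \<le> (x - real n) / real n" using n x by (intro ln_diff_le) auto
      also have "\<dots> \<le> 1 / 2" using n by (intro frac_le) auto
      finally have "(ln x - ln (real n)) / ln (real n) \<le> (1 / 2) / (1 / 2)"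
        using half by (intro frac_le) auto
      moreover have "ln (ln x) - ln (ln (real n)) \<le> (ln x - ln (real n)) / ln (real n)"
        using half x by (intro ln_diff_le) auto
      ultimately show ?thesis by simp
    qed
    ultimately show ?thesis using C[OF n(1)] by simp
  qed
  then show thesis by (rule that)
qed

section \<open>Chaining along dyadic intervals\<close>

text \<open>Each \<open>j < 2 ^ r\<close> is reached from \<open>0\<close> by at most \<open>r\<close> dyadic steps, one of each length
  \<open>2 ^ s\<close>, obtained by truncating the binary expansion of \<open>j\<close>.\<close>

lemma dyadic_chain_square_le:
  fixes f :: "nat \<Rightarrow> real"
  assumes "j < 2 ^ r"
  shows "(f j - f 0)\<^sup>2 \<le> real r * (\<Sum>s<r. \<Sum>u<2 ^ (r - s). (f ((u + 1) * 2 ^ s) - f (u * 2 ^ s))\<^sup>2)"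
proof -
  \<comment> \<open>\<open>h s\<close> evaluates \<open>f\<close> at \<open>j\<close> with its
    lowest \<open>s\<close> binary digits cleared.\<close>
  define h where "h s = f (j div 2 ^ s * 2 ^ s)" for s
  have "(\<Sum>s<r. h s - h (Suc s)) = h 0 - h r" by (rule sum_lessThan_telescope')
  also have "\<dots> = f j - f 0" using assms by (simp add: h_def)
  finally have "(f j - f 0)\<^sup>2 = (\<Sum>s<r. h s - h (Suc s))\<^sup>2" by simp
  \<comment> \<open>Cauchy-Schwarz over the \<open>r\<close> steps produces the factor
    \<open>r\<close>.\<close>
  also have "\<dots> \<le> (\<Sum>s<r. (h s - h (Suc s))\<^sup>2) * real (card {..<r})"
    by (rule sum_squared_le_sum_of_squares)
  also have "\<dots> = real r * (\<Sum>s<r. (h s - h (Suc s))\<^sup>2)" by simp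
  also have "\<dots> \<le> real r * (\<Sum>s<r. \<Sum>u<2 ^ (r - s). (f ((u + 1) * 2 ^ s) - f (u * 2 ^ s))\<^sup>2)"
  proof (intro mult_left_mono sum_mono)
    fix s assume s: "s \<in> {..<r}"
    let ?d = "\<lambda>u. (f ((u + 1) * 2 ^ s) - f (u * 2 ^ s))\<^sup>2"
    define q where "q = j div 2 ^ s"
    have q2: "j div 2 ^ Suc s = q div 2"
      unfolding q_def by (simp only: power_Suc2 div_mult2_eq)
    have "2 ^ r = (2::nat) ^ (r - s) * 2 ^ s" using s by (simp flip: power_add)
    then have q: "q < 2 ^ (r - s)"
      unfolding q_def using assms by (simp add: less_mult_imp_div_less)
    \<comment> \<open>If the last digit of \<open>q\<close> is 0, clearing it changes nothing;
      otherwise the step crosses the dyadic interval of index \<open>q - 1\<close>.\<close>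
    show "(h s - h (Suc s))\<^sup>2 \<le> (\<Sum>u<2 ^ (r - s). ?d u)"
    proof (cases "even q")
      case True
      then have "q div 2 * 2 ^ Suc s = q * 2 ^ s" by (auto elim!: evenE)
      then have "h (Suc s) = h s" unfolding h_def q2 q_def[symmetric] by (simp only:)
      then show ?thesis by (simp add: sum_nonneg)
    next
      case False
      then obtain t where t: "q = 2 * t + 1" by (auto elim!: oddE)
      have "(h s - h (Suc s))\<^sup>2 = ?d (2 * t)"
        unfolding h_def q2 q_def[symmetric] t by (simp add: algebra_simps)
      also have "\<dots> \<le> (\<Sum>u<2 ^ (r - s). ?d u)"
        by (rule member_le_sum) (use q t in auto)
      finally show ?thesis .
    qed
  qed simp
  finally show ?thesis .
qed

text \<open>\<open>G r\<close> collects the squared increments over all dyadic intervals in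
  \<open>[0, 2 ^ r]\<close>. Each of the \<open>r\<close> lengths contributes at most
  \<open>K * 2 ^ r\<close> in expectation. A weighted series of the \<open>G r\<close> then has
  finite expectation, so it converges almost surely, and its sum bounds every term at once.\<close>

lemma AE_dyadic_bound:
  fixes F :: "nat \<Rightarrow> 'a \<Rightarrow> real"
  assumes [measurable]: "\<And>j. F j \<in> borel_measurable M"
    and mom: "\<And>i j. i \<le> j \<Longrightarrow> (\<integral>\<^sup>+\<omega>. ennreal ((F j \<omega> - F i \<omega>)\<^sup>2) \<partial>M) \<le> ennreal (K * real (j - i))"
    and "K \<ge> 0"
  shows "AE \<omega> in M. \<exists>C\<ge>0. \<forall>r. \<forall>j<2 ^ r. (F j \<omega> - F 0 \<omega>)\<^sup>2 \<le> C * (real r + 1) ^ 4 * 2 ^ r"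
proof -
  define G where "G r \<omega> = (\<Sum>s<r. \<Sum>u<2 ^ (r - s). (F ((u + 1) * 2 ^ s) \<omega> - F (u * 2 ^ s) \<omega>)\<^sup>2)"
    for r \<omega>
  \<comment> \<open>The weight makes the expectation of \<open>w r * G r\<close> at most
    \<open>K / (r + 1) ^ 2\<close>, which is summable. The chaining factor \<open>r\<close> later
    raises the cube to a fourth power.\<close>
  define w where "w r = 1 / ((real r + 1) ^ 3 * 2 ^ r)" for r :: nat
  have w: "w r > 0" for r by (simp add: w_def add_nonneg_pos)
  have G0: "G r \<omega> \<ge> 0" for r \<omega> unfolding G_def by (intro sum_nonneg) auto
  have [measurable]: "G r \<in> borel_measurable M" for r unfolding G_def by measurable
  have EG: "(\<integral>\<^sup>+\<omega>. ennreal (G r \<omega>) \<partial>M) \<le> ennreal (K * real r * 2 ^ r)" for r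
  proof -
    have "(\<integral>\<^sup>+\<omega>. ennreal (G r \<omega>) \<partial>M) =
      (\<Sum>s<r. \<Sum>u<2 ^ (r - s). \<integral>\<^sup>+\<omega>. ennreal ((F ((u + 1) * 2 ^ s) \<omega> - F (u * 2 ^ s) \<omega>)\<^sup>2) \<partial>M)"
      unfolding G_def by (simp add: sum_nonneg nn_integral_sum flip: sum_ennreal)
    also have "\<dots> \<le> (\<Sum>s<r. \<Sum>u<(2::nat) ^ (r - s). ennreal (K * 2 ^ s))"
    proof (intro sum_mono)
      fix s u :: nat
      have "(u + 1) * 2 ^ s - u * 2 ^ s = 2 ^ s" by (simp add: algebra_simps)
      then show "(\<integral>\<^sup>+\<omega>. ennreal ((F ((u + 1) * 2 ^ s) \<omega> - F (u * 2 ^ s) \<omega>)\<^sup>2) \<partial>M) \<le> ennreal (K * 2 ^ s)"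
        using mom[of "u * 2 ^ s" "(u + 1) * 2 ^ s"] by simp
    qed
    also have "\<dots> = ennreal (\<Sum>s<r. \<Sum>u<(2::nat) ^ (r - s). K * 2 ^ s)"
      using \<open>K \<ge> 0\<close> by (simp only: sum_ennreal sum_nonneg mult_nonneg_nonneg zero_le_power zero_le_numeral)
    also have "(\<Sum>s<r. \<Sum>u<(2::nat) ^ (r - s). K * 2 ^ s) = (\<Sum>s<r. K * 2 ^ r)"
    proof (intro sum.cong refl)
      fix s assume "s \<in> {..<r}"
      then have "(2::real) ^ r = 2 ^ (r - s) * 2 ^ s" by (simp flip: power_add)
      then show "(\<Sum>u<(2::nat) ^ (r - s). K * 2 ^ s) = K * 2 ^ r" by simp
    qed
    finally show ?thesis by (simp add: mult_ac)
  qed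
  have "(\<integral>\<^sup>+\<omega>. (\<Sum>r. ennreal (w r * G r \<omega>)) \<partial>M) = (\<Sum>r. \<integral>\<^sup>+\<omega>. ennreal (w r * G r \<omega>) \<partial>M)"
    by (rule nn_integral_suminf) measurable
  also have "\<dots> \<le> (\<Sum>r. ennreal (K * (1 / real (Suc r) ^ 2)))"
  proof (intro suminf_le summableI)
    fix r
    have "(\<integral>\<^sup>+\<omega>. ennreal (w r * G r \<omega>) \<partial>M) = ennreal (w r) * (\<integral>\<^sup>+\<omega>. ennreal (G r \<omega>) \<partial>M)"
      using w[of r] by (subst nn_integral_cmult[symmetric]) (auto simp: ennreal_mult' less_imp_le)
    also have "\<dots> \<le> ennreal (w r) * ennreal (K * real r * 2 ^ r)" by (intro mult_left_mono EG) simp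
    also have "\<dots> = ennreal (K * (real r / (real r + 1) ^ 3))"
      using w[of r] \<open>K \<ge> 0\<close> by (simp add: w_def flip: ennreal_mult)
    also have "\<dots> \<le> ennreal (K * (1 / real (Suc r) ^ 2))"
    proof (intro ennreal_leI mult_left_mono \<open>K \<ge> 0\<close>)
      have "real r / (real r + 1) ^ 3 \<le> (real r + 1) / (real r + 1) ^ 3" by (intro divide_right_mono) auto
      also have "\<dots> = 1 / (real r + 1) ^ 2"
        by (simp add: divide_simps eval_nat_numeral)
      finally show "real r / (real r + 1) ^ 3 \<le> 1 / real (Suc r) ^ 2" by (simp add: add.commute)
    qed
    finally show "(\<integral>\<^sup>+\<omega>. ennreal (w r * G r \<omega>) \<partial>M) \<le> ennreal (K * (1 / real (Suc r) ^ 2))" .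
  qed
  also have "\<dots> = ennreal (\<Sum>r. K * (1 / real (Suc r) ^ 2))"
  proof (intro suminf_ennreal2 summable_mult)
    show "summable (\<lambda>r. 1 / real (Suc r) ^ 2)"
      using inverse_power_summable[of 2, where ?'a = real]
      by (subst summable_Suc_iff) (simp add: inverse_eq_divide)
  qed (use \<open>K \<ge> 0\<close> in auto)
  also have "\<dots> < \<infinity>" by simp
  finally have "AE \<omega> in M. (\<Sum>r. ennreal (w r * G r \<omega>)) \<noteq> \<infinity>"
    by (intro nn_integral_noteq_infinite) auto
  then show ?thesis
  proof (rule AE_mp, intro AE_I2 impI)
    fix \<omega> assume fin: "(\<Sum>r. ennreal (w r * G r \<omega>)) \<noteq> \<infinity>"
    define C where "C = enn2real (\<Sum>r. ennreal (w r * G r \<omega>))"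
    have GC: "G r \<omega> \<le> C * ((real r + 1) ^ 3 * 2 ^ r)" for r
    proof -
      have "ennreal (w r * G r \<omega>) = (\<Sum>r\<in>{r}. ennreal (w r * G r \<omega>))" by simp
      also have "\<dots> \<le> (\<Sum>r. ennreal (w r * G r \<omega>))" by (intro sum_le_suminf summableI) auto
      also have "\<dots> = ennreal C" unfolding C_def using fin by (simp add: less_top)
      finally have "w r * G r \<omega> \<le> C" by (simp add: C_def)
      then show ?thesis by (simp add: w_def divide_simps mult_ac)
    qed
    show "\<exists>C\<ge>0. \<forall>r. \<forall>j<2 ^ r. (F j \<omega> - F 0 \<omega>)\<^sup>2 \<le> C * (real r + 1) ^ 4 * 2 ^ r"
    proof (intro exI[of _ C] conjI allI impI)
      show C0: "C \<ge> 0" by (simp add: C_def)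
      fix r j :: nat assume "j < 2 ^ r"
      then have "(F j \<omega> - F 0 \<omega>)\<^sup>2 \<le> real r * G r \<omega>"
        unfolding G_def by (rule dyadic_chain_square_le)
      also have "\<dots> \<le> (real r + 1) * (C * ((real r + 1) ^ 3 * 2 ^ r))"
        using GC[of r] G0 by (intro mult_mono) auto
      finally show "(F j \<omega> - F 0 \<omega>)\<^sup>2 \<le> C * (real r + 1) ^ 4 * 2 ^ r"
        by (simp add: eval_nat_numeral mult_ac)
    qed
  qed
qed

text \<open>For \<open>2 ^ r \<le> j < 2 ^ (r + 1)\<close> the hypothesis is applied at
  \<open>r + 1\<close>; the polynomial factor in \<open>r\<close> is absorbed by
  \<open>2 powr (2 * \<epsilon> * r)\<close>, at the cost of the constant \<open>D\<close>.\<close>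

lemma dyadic_bound_imp_powr_bound:
  fixes f :: "nat \<Rightarrow> real"
  assumes bound: "\<And>r j. j < 2 ^ r \<Longrightarrow> (f j)\<^sup>2 \<le> C * (real r + 1) ^ 4 * 2 ^ r"
    and "C \<ge> 0" "\<epsilon> > 0"
  shows "\<exists>B\<ge>0. \<forall>j\<ge>1. \<bar>f j\<bar> \<le> B * real j powr (1 / 2 + \<epsilon>)"
proof -
  have "(\<lambda>r. (real r + 2) ^ 4 / 2 powr (2 * \<epsilon> * real r)) \<longlonglongrightarrow> 0"
    using \<open>\<epsilon> > 0\<close> by real_asymp
  then have "Bseq (\<lambda>r. (real r + 2) ^ 4 / 2 powr (2 * \<epsilon> * real r))"
    by (intro convergent_imp_Bseq) (auto simp: convergent_def)
  then obtain D where D: "D > 0" "\<And>r. (real r + 2) ^ 4 / 2 powr (2 * \<epsilon> * real r) \<le> D"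
    by (force simp: Bseq_def)
  have "\<bar>f j\<bar> \<le> sqrt (2 * C * D) * real j powr (1 / 2 + \<epsilon>)" if j: "j \<ge> 1" for j
  proof -
    obtain r where r: "2 ^ r \<le> j" "j < 2 ^ (r + 1)"
      using ex_power_ivl1[OF order_refl j] by blast
    have "(f j)\<^sup>2 \<le> C * (real r + 2) ^ 4 * 2 ^ (r + 1)"
      using bound[OF r(2)] by (simp add: add.commute)
    also have "\<dots> \<le> C * (D * 2 powr (2 * \<epsilon> * real r)) * 2 ^ (r + 1)"
      using D(2)[of r] \<open>C \<ge> 0\<close> by (intro mult_right_mono mult_left_mono) (auto simp: field_simps)
    also have "\<dots> = 2 * C * D * (2 powr (real r)) powr (1 + 2 * \<epsilon>)"
    proof -
      have "(2 powr real r) powr (1 + 2 * \<epsilon>) = 2 powr real r * 2 powr (2 * \<epsilon> * real r)"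
        by (simp only: powr_powr powr_add[symmetric]) (simp add: algebra_simps)
      moreover have "2 powr real r = (2::real) ^ r" by (simp add: powr_realpow)
      ultimately show ?thesis by (simp add: mult_ac)
    qed
    also have "\<dots> \<le> 2 * C * D * real j powr (1 + 2 * \<epsilon>)"
      using r(1) D(1) \<open>C \<ge> 0\<close> \<open>\<epsilon> > 0\<close>
      by (intro mult_left_mono powr_mono2) (auto simp: powr_realpow simp flip: of_nat_power)
    also have "\<dots> = (sqrt (2 * C * D) * real j powr (1 / 2 + \<epsilon>))\<^sup>2"
    proof -
      have "(real j powr (1 / 2 + \<epsilon>))\<^sup>2 = real j powr ((1 / 2 + \<epsilon>) + (1 / 2 + \<epsilon>))"
        unfolding power2_eq_square powr_add ..
      then have "(real j powr (1 / 2 + \<epsilon>))\<^sup>2 = real j powr (1 + 2 * \<epsilon>)" by simp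
      then show ?thesis using D(1) \<open>C \<ge> 0\<close> by (simp add: power_mult_distrib)
    qed
    finally have "\<bar>f j\<bar>\<^sup>2 \<le> (sqrt (2 * C * D) * real j powr (1 / 2 + \<epsilon>))\<^sup>2" by simp
    then show ?thesis by (rule power2_le_imp_le) (use D(1) \<open>C \<ge> 0\<close> in auto)
  qed
  then show ?thesis using D(1) \<open>C \<ge> 0\<close> by (intro exI[of _ "sqrt (2 * C * D)"]) auto
qed

section \<open>Hitting probabilities\<close>

lemma prob_space_lambda01: "prob_space lambda01"
  by (rule prob_spaceI) (simp add: emeasure_restrict_space)

interpretation J: pair_prob_space Omega lambda01
proof -
  interpret A: prob_space Omega by (rule prob_space_Omega)
  interpret B: prob_space lambda01 by (rule prob_space_lambda01)
  show "pair_prob_space Omega lambda01" ..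
qed

abbreviation joint :: "((nat \<Rightarrow> int) \<times> real) measure" where
  "joint \<equiv> Omega \<Otimes>\<^sub>M lambda01"

lemma emeasure_Omega_cylinder:
  assumes "finite P" "\<And>p. p \<in> P \<Longrightarrow> prime p \<and> i p \<in> {0..<int p}"
  shows "emeasure Omega {a \<in> space Omega. \<forall>p\<in>P. a p = i p} = ennreal (\<Prod>p\<in>P. 1 / real p)"
proof -
  \<comment> \<open>The product locale asks for a probability space at every index, so a one-point
    space is placed at the non-primes, where \<open>{0..<int p}\<close> may be empty.\<close>
  define M where "M p = (if prime p then uniform_count_measure {0..<int p} else uniform_count_measure {0})"
    for p :: nat
  have Omega_eq: "Omega = Pi\<^sub>M {p. prime p} M"
    unfolding Omega_def M_def by (intro PiM_cong) auto
  have "prob_space (M p)" for p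
    unfolding M_def by (auto intro!: prob_space_uniform_count_measure dest: prime_gt_0_nat)
  then interpret product_prob_space M "{p. prime p}"
    by (auto simp: product_prob_space_def product_prob_space_axioms_def product_sigma_finite_def
        intro: prob_space_imp_sigma_finite)
  have "emeasure Omega {a \<in> space Omega. \<forall>p\<in>P. a p \<in> {i p}} = (\<Prod>p\<in>P. emeasure (M p) {i p})"
    unfolding Omega_eq using assms
    by (intro emeasure_PiM_Collect) (auto simp: M_def sets_uniform_count_measure)
  also have "\<dots> = (\<Prod>p\<in>P. ennreal (1 / real p))"
    using assms by (intro prod.cong refl) (auto simp: M_def emeasure_uniform_count_measure)
  also have "\<dots> = ennreal (\<Prod>p\<in>P. 1 / real p)" by (intro prod_ennreal) simp
  finally show ?thesis by simp
qed

lemma space_Omega_coordinate: "a \<in> space Omega \<Longrightarrow> prime p \<Longrightarrow> a p \<in> {0..<int p}"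
  unfolding space_Omega by (drule PiE_mem[of _ _ _ p]) auto

lemma sets_Omega_coordinate [measurable]:
  assumes "prime p"
  shows "{a \<in> space Omega. a p = i} \<in> sets Omega"
proof -
  have "(\<lambda>a. a p) \<in> Omega \<rightarrow>\<^sub>M uniform_count_measure {0..<int p}"
    unfolding Omega_def by (rule measurable_component_singleton) (use assms in simp)
  then have "(\<lambda>a. a p) -` ({i} \<inter> {0..<int p}) \<inter> space Omega \<in> sets Omega"
    by (rule measurable_sets) (auto simp: sets_uniform_count_measure)
  moreover have "(\<lambda>a. a p) -` ({i} \<inter> {0..<int p}) \<inter> space Omega = {a \<in> space Omega. a p = i}"
    using space_Omega_coordinate[OF _ assms] by auto
  ultimately show ?thesis by simp
qed

definition window :: "real \<Rightarrow> nat \<Rightarrow> int \<Rightarrow> real set" where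
  "window c p i = {x \<in> {0..1}. \<bar>x - real_of_int i / real p\<bar> \<le> c / real p}"

lemma window_eq: "window c p i = {max 0 (real_of_int i / real p - c / real p)..min 1 (real_of_int i / real p + c / real p)}"
  by (auto simp: window_def)

lemma sets_window [measurable]: "window c p i \<in> sets lambda01"
  unfolding window_eq by (auto simp: sets_restrict_space_iff)

lemma measure_lambda01_Icc:
  assumes "0 \<le> a" "b \<le> 1"
  shows "measure lambda01 {a..b} = max 0 (b - a)"
proof -
  have "{a..b} \<subseteq> {0..1}" using assms by auto
  then show ?thesis by (simp add: measure_restrict_space max_def)
qed

definition hit :: "real \<Rightarrow> nat \<Rightarrow> ((nat \<Rightarrow> int) \<times> real) set" where
  "hit c p = {w \<in> space joint. \<bar>snd w - real_of_int (fst w p) / real p\<bar> \<le> c / real p}"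

text \<open>A decomposition into finitely many disjoint rectangles: it yields measurability and
  reduces probabilities to lengths of windows.\<close>

lemma hit_eq:
  assumes "prime p"
  shows "hit c p = (\<Union>i\<in>{0..<int p}. {a \<in> space Omega. a p = i} \<times> window c p i)"
  using space_Omega_coordinate[OF _ assms]
  by (fastforce simp: hit_def window_def space_pair_measure)

lemma sets_hit [measurable]: "prime p \<Longrightarrow> hit c p \<in> sets joint"
  unfolding hit_eq by (intro sets.finite_UN pair_measureI) auto

lemma measure_joint_cylinder:
  assumes "finite P" "\<And>p. p \<in> P \<Longrightarrow> prime p \<and> i p \<in> {0..<int p}" "X \<in> sets lambda01"
  shows "measure joint ({a \<in> space Omega. \<forall>p\<in>P. a p = i p} \<times> X) = (\<Prod>p\<in>P. 1 / real p) * measure lambda01 X"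
proof -
  have "{a \<in> space Omega. \<forall>p\<in>P. a p = i p} \<in> sets Omega"
    using assms by (intro sets.sets_Collect_finite_All) auto
  then have "emeasure joint ({a \<in> space Omega. \<forall>p\<in>P. a p = i p} \<times> X) =
      ennreal (\<Prod>p\<in>P. 1 / real p) * emeasure lambda01 X"
    using assms by (subst J.M2.emeasure_pair_measure_Times) (simp_all add: emeasure_Omega_cylinder)
  then show ?thesis by (simp add: measure_def enn2real_mult prod_nonneg)
qed

lemma measure_window_le: "0 \<le> c \<Longrightarrow> measure lambda01 (window c p i) \<le> 2 * c / real p"
  unfolding window_eq using divide_nonneg_nonneg[of c "real p"]
  by (subst measure_lambda01_Icc) (auto simp: max_def min_def)

lemma measure_window_pos:
  assumes "0 \<le> c" "c \<le> 1 / 2" "i \<in> {1..<int p}"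
  shows "measure lambda01 (window c p i) = 2 * c / real p"
proof -
  have "real_of_int i / real p - c / real p \<ge> 0" "real_of_int i / real p + c / real p \<le> 1"
  proof -
    have "real_of_int i \<ge> 1" "real_of_int i + 1 \<le> real p" using assms(3) by auto
    then show "real_of_int i / real p - c / real p \<ge> 0" "real_of_int i / real p + c / real p \<le> 1"
      using assms(1,2) by (auto simp: field_simps)
  qed
  then show ?thesis
    unfolding window_eq using assms by (subst measure_lambda01_Icc) (auto simp: max_def min_def)
qed

lemma measure_window_0:
  assumes "0 \<le> c" "c \<le> 1" "p > 0"
  shows "measure lambda01 (window c p 0) = c / real p"
  unfolding window_eq using assms
  by (subst measure_lambda01_Icc) (auto simp: max_def min_def field_simps)

text \<open>For \<open>c \<le> 1 / 2\<close> only the window at \<open>i = 0\<close> leaves the unit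
  interval; losing its left half accounts for the term \<open>c / p ^ 2\<close>.\<close>

lemma measure_hit:
  assumes "prime p" "0 \<le> c" "c \<le> 1 / 2"
  shows "measure joint (hit c p) = 2 * c / real p - c / (real p)\<^sup>2"
proof -
  have p: "p > 0" using assms prime_gt_0_nat by auto
  have "measure joint (hit c p) = (\<Sum>i\<in>{0..<int p}. measure joint ({a \<in> space Omega. a p = i} \<times> window c p i))"
    unfolding hit_eq[OF assms(1)] using assms(1)
    by (intro J.P.finite_measure_finite_Union) (auto simp: disjoint_family_on_def)
  also have "\<dots> = (\<Sum>i\<in>{0..<int p}. 1 / real p * measure lambda01 (window c p i))"
    using assms(1) measure_joint_cylinder[of "{p}" "\<lambda>_. i" "window c p i" for i]
    by (intro sum.cong refl) simp
  also have "{0..<int p} = insert 0 {1..<int p}" using p by auto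
  also have "(\<Sum>i\<in>insert 0 {1..<int p}. 1 / real p * measure lambda01 (window c p i)) =
     1 / real p * (c / real p) + (\<Sum>i\<in>{1..<int p}. 1 / real p * (2 * c / real p))"
    using assms p by (simp add: measure_window_0 measure_window_pos)
  also have "\<dots> = 2 * c / real p - c / (real p)\<^sup>2"
    using p by (simp add: of_nat_diff nat_diff_distrib field_simps power2_eq_square)
  finally show ?thesis .
qed

lemma card_int_near_le:
  assumes "R \<ge> 0"
  shows "finite {j::int. \<bar>real_of_int j - y\<bar> \<le> R}"
    "real (card {j::int. \<bar>real_of_int j - y\<bar> \<le> R}) \<le> 2 * R + 1"
proof -
  have *: "{j::int. \<bar>real_of_int j - y\<bar> \<le> R} = {\<lceil>y - R\<rceil>..\<lfloor>y + R\<rfloor>}"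
    by (auto simp: abs_le_iff ceiling_le_iff le_floor_iff)
  show "finite {j::int. \<bar>real_of_int j - y\<bar> \<le> R}" unfolding * by simp
  show "real (card {j::int. \<bar>real_of_int j - y\<bar> \<le> R}) \<le> 2 * R + 1"
    unfolding * using assms by simp linarith
qed

text \<open>Around each window of the smaller prime, the windows of the larger one are counted. This
  puts the error at order \<open>1 / q ^ 2\<close>, while the leading term is the product of
  \<open>2 * c / p\<close> and \<open>2 * c / q\<close>.\<close>

lemma measure_hit_Int_le:
  assumes "prime p" "prime q" "p < q" "0 \<le> c" "c \<le> 1 / 2"
  shows "measure joint (hit c p \<inter> hit c q) \<le> 4 * c\<^sup>2 / (real p * real q) + 4 * c / (real q)\<^sup>2"
proof -
  have pq: "real p > 0" "real q > 0" using assms prime_gt_0_nat by auto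
  \<comment> \<open>Since \<open>p\<close> and \<open>q\<close> differ, fixing both coordinates
    gives a cylinder of measure \<open>1 / (p * q)\<close>.\<close>
  define A where "A i j = {a \<in> space Omega. \<forall>r\<in>{p, q}. a r = (if r = p then i else j)} \<times> (window c p i \<inter> window c q j)"
    for i j
  have A_sets: "A i j \<in> sets joint" for i j
    unfolding A_def using assms by (intro pair_measureI sets.sets_Collect_finite_All) auto
  have A: "measure joint (A i j) = 1 / (real p * real q) * measure lambda01 (window c p i \<inter> window c q j)"
    if "i \<in> {0..<int p}" "j \<in> {0..<int q}" for i j
    unfolding A_def using assms that by (subst measure_joint_cylinder) auto
  have row: "(\<Sum>j\<in>{0..<int q}. measure lambda01 (window c p i \<inter> window c q j)) \<le> 4 * c\<^sup>2 / real p + 4 * c / real q"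
    for i
  proof -
    define R where "R = c * real q / real p + c"
    have "R \<ge> 0" unfolding R_def using assms by simp
    define S where "S = {j::int. \<bar>real_of_int j - real q * real_of_int i / real p\<bar> \<le> R}"
    note S = card_int_near_le[OF \<open>R \<ge> 0\<close>, of "real q * real_of_int i / real p", folded S_def]
    \<comment> \<open>Windows that meet have centers within \<open>c / p + c / q\<close>, which
      after scaling by \<open>q\<close> means \<open>j \<in> S\<close>; the overlap is then bounded
      by the whole window of \<open>q\<close>.\<close>
    have "measure lambda01 (window c p i \<inter> window c q j) \<le> (if j \<in> S then 2 * c / real q else 0)" for j
    proof (cases "window c p i \<inter> window c q j = {}")
      case True
      then show ?thesis using assms by simp
    next
      case False
      then obtain x where "\<bar>x - real_of_int i / real p\<bar> \<le> c / real p" "\<bar>x - real_of_int j / real q\<bar> \<le> c / real q"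
        by (auto simp: window_def)
      then have "\<bar>real_of_int j / real q - real_of_int i / real p\<bar> \<le> c / real p + c / real q" by linarith
      then have "real q * \<bar>real_of_int j / real q - real_of_int i / real p\<bar> \<le> real q * (c / real p + c / real q)"
        using pq by (intro mult_left_mono) auto
      also have "real q * \<bar>real_of_int j / real q - real_of_int i / real p\<bar> =
          \<bar>real q * (real_of_int j / real q - real_of_int i / real p)\<bar>"
        using pq by (simp add: abs_mult)
      finally have "j \<in> S" unfolding S_def R_def using pq by (simp add: right_diff_distrib distrib_left mult_ac)
      moreover have "measure lambda01 (window c p i \<inter> window c q j) \<le> measure lambda01 (window c q j)"
        by (intro J.M2.finite_measure_mono) auto
      ultimately show ?thesis using measure_window_le[OF assms(4), of q j] by simp
    qed
    then have "(\<Sum>j\<in>{0..<int q}. measure lambda01 (window c p i \<inter> window c q j)) \<le>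
        (\<Sum>j\<in>{0..<int q}. if j \<in> S then 2 * c / real q else 0)" by (intro sum_mono)
    also have "\<dots> = (\<Sum>j\<in>{0..<int q} \<inter> S. 2 * c / real q)" by (rule sum.inter_restrict[symmetric]) simp
    also have "\<dots> \<le> (\<Sum>j\<in>S. 2 * c / real q)" using S(1) assms by (intro sum_mono2) auto
    also have "\<dots> \<le> (2 * R + 1) * (2 * c / real q)"
      using S(2) assms by (simp only: sum_constant) (intro mult_right_mono, auto)
    also have "\<dots> = 4 * c\<^sup>2 / real p + (2 * c + 1) * (2 * c / real q)"
      unfolding R_def using pq by (simp add: field_simps power2_eq_square)
    also have "(2 * c + 1) * (2 * c / real q) \<le> 2 * (2 * c / real q)"
      using assms by (intro mult_right_mono) auto
    finally show ?thesis by simp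
  qed
  have "hit c p \<inter> hit c q \<subseteq> (\<Union>(i, j)\<in>{0..<int p} \<times> {0..<int q}. A i j)"
    unfolding hit_eq[OF assms(1)] hit_eq[OF assms(2)] A_def using assms(3) by auto
  then have "measure joint (hit c p \<inter> hit c q) \<le> measure joint (\<Union>(i, j)\<in>{0..<int p} \<times> {0..<int q}. A i j)"
    using A_sets by (intro J.P.finite_measure_mono) auto
  also have "\<dots> \<le> (\<Sum>(i, j)\<in>{0..<int p} \<times> {0..<int q}. measure joint (A i j))"
    using A_sets J.P.finite_measure_subadditive_finite[of "{0..<int p} \<times> {0..<int q}" "\<lambda>(i, j). A i j"]
    by (auto simp: case_prod_unfold)
  also have "\<dots> = (\<Sum>i\<in>{0..<int p}. \<Sum>j\<in>{0..<int q}. measure joint (A i j))"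
    by (simp add: sum.cartesian_product)
  also have "\<dots> = (\<Sum>i\<in>{0..<int p}. 1 / (real p * real q) *
      (\<Sum>j\<in>{0..<int q}. measure lambda01 (window c p i \<inter> window c q j)))"
    unfolding sum_distrib_left by (intro sum.cong refl A)
  also have "\<dots> \<le> (\<Sum>i\<in>{0..<int p}. 1 / (real p * real q) * (4 * c\<^sup>2 / real p + 4 * c / real q))"
    by (intro sum_mono mult_left_mono row) simp
  also have "\<dots> = 4 * c\<^sup>2 / (real p * real q) + 4 * c / (real q)\<^sup>2"
    using pq by (simp add: field_simps power2_eq_square)
  finally show ?thesis .
qed

section \<open>Second moments of centered hit counts\<close>

lemma sum_inverse_squares_le:
  fixes B :: "nat set"
  assumes "finite B" "\<And>p. p \<in> B \<Longrightarrow> p \<ge> 2"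
  shows "(\<Sum>p\<in>B. 1 / (real p)\<^sup>2) \<le> 1"
proof -
  obtain N where N: "B \<subseteq> {2..N}" "N \<ge> 2"
  proof
    show "B \<subseteq> {2..Max (insert 2 B)}" using assms by auto
    show "Max (insert 2 B) \<ge> 2" using assms by simp
  qed
  have "(\<Sum>p\<in>B. 1 / (real p)\<^sup>2) \<le> (\<Sum>p=2..N. 1 / (real p)\<^sup>2)"
    using N by (intro sum_mono2) auto
  \<comment> \<open>The sharper bound \<open>1 - 1 / N\<close> is what makes the induction
    telescope.\<close>
  also have "\<dots> \<le> 1 - 1 / real N"
    using N(2)
  proof (induction N rule: nat_induct_at_least)
    case (Suc n)
    have "1 / (real (Suc n))\<^sup>2 \<le> 1 / real n - 1 / real (Suc n)"
      using Suc by (simp add: divide_simps power2_eq_square)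
    with Suc show ?case by simp
  qed (simp add: power2_eq_square)
  also have "\<dots> \<le> 1" by simp
  finally show ?thesis .
qed

text \<open>Centered at \<open>2 * c / p\<close> instead of the exact mean, so that sums over primes
  involve exactly the Mertens sum; the discrepancy \<open>c / p ^ 2\<close> reappears as correction
  terms in \<open>integral_dev_mult\<close>.\<close>

definition dev :: "real \<Rightarrow> nat \<Rightarrow> (nat \<Rightarrow> int) \<times> real \<Rightarrow> real" where
  "dev c p w = indicator (hit c p) w - 2 * c / real p"

lemma borel_measurable_dev [measurable]: "prime p \<Longrightarrow> dev c p \<in> borel_measurable joint"
  unfolding dev_def by measurable

lemma dev_mult_eq:
  "dev c p w * dev c q w = indicator (hit c p \<inter> hit c q) w - 2 * c / real q * indicator (hit c p) w
      - 2 * c / real p * indicator (hit c q) w + 2 * c / real p * (2 * c / real q)"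
  by (simp add: dev_def indicator_inter_arith algebra_simps)

lemma integrable_dev_mult:
  assumes "prime p" "prime q"
  shows "integrable joint (\<lambda>w. dev c p w * dev c q w)"
  unfolding dev_mult_eq using assms
  by (intro Bochner_Integration.integrable_add Bochner_Integration.integrable_diff integrable_mult_right
      integrable_real_indicator J.P.integrable_const sets.Int sets_hit) (auto simp: J.P.emeasure_eq_measure)

lemma integral_dev_mult:
  assumes "prime p" "prime q" "0 \<le> c" "c \<le> 1 / 2"
  shows "(\<integral>w. dev c p w * dev c q w \<partial>joint) = measure joint (hit c p \<inter> hit c q)
    - 4 * c\<^sup>2 / (real p * real q) + 2 * c\<^sup>2 / (real q * (real p)\<^sup>2) + 2 * c\<^sup>2 / (real p * (real q)\<^sup>2)"
proof -
  have pq: "real p > 0" "real q > 0" using assms prime_gt_0_nat by auto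
  have ind: "integrable joint (indicator A :: _ \<Rightarrow> real)" if "A \<in> sets joint" for A
    using that by (intro integrable_real_indicator) (auto simp: J.P.emeasure_eq_measure)
  have sets: "hit c p \<in> sets joint" "hit c q \<in> sets joint" "hit c p \<inter> hit c q \<in> sets joint"
    using assms by auto
  have space: "A \<inter> space joint = A" if "A \<in> sets joint" for A
    using sets.sets_into_space[OF that] by auto
  have "(\<integral>w. dev c p w * dev c q w \<partial>joint) = measure joint (hit c p \<inter> hit c q)
      - 2 * c / real q * measure joint (hit c p) - 2 * c / real p * measure joint (hit c q)
      + 2 * c / real p * (2 * c / real q)"
    unfolding dev_mult_eq using sets
    by (simp only: Bochner_Integration.integral_add Bochner_Integration.integral_diff
        Bochner_Integration.integrable_add Bochner_Integration.integrable_diff integrable_mult_right ind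
        J.P.integrable_const integral_mult_right_zero Bochner_Integration.integral_indicator space
        lebesgue_integral_const J.P.prob_space) simp
  also have "\<dots> = measure joint (hit c p \<inter> hit c q) - 4 * c\<^sup>2 / (real p * real q)
      + 2 * c\<^sup>2 / (real q * (real p)\<^sup>2) + 2 * c\<^sup>2 / (real p * (real q)\<^sup>2)"
    unfolding measure_hit[OF assms(1,3,4)] measure_hit[OF assms(2,3,4)]
    using pq by (simp add: field_simps power2_eq_square)
  finally show ?thesis .
qed

lemma integral_dev_square_le:
  assumes "prime p" "0 \<le> c" "c \<le> 1 / 2"
  shows "(\<integral>w. dev c p w * dev c p w \<partial>joint) \<le> 1 / real p"
proof -
  have p: "real p \<ge> 1" using assms prime_ge_1_nat by auto
  have "2 * c\<^sup>2 / (real p * (real p)\<^sup>2) + 2 * c\<^sup>2 / (real p * (real p)\<^sup>2) \<le> 4 * c\<^sup>2 / (real p * real p)"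
    unfolding add_divide_distrib[symmetric]
    using p by (intro frac_le) (auto simp: power2_eq_square)
  moreover have "2 * c / real p \<le> 1 / real p" using assms p by (intro divide_right_mono) auto
  moreover have "c / (real p)\<^sup>2 \<ge> 0" using assms by simp
  ultimately show ?thesis
    unfolding integral_dev_mult[OF assms(1,1,2,3)] Int_absorb measure_hit[OF assms] by linarith
qed

text \<open>The leading terms \<open>4 * c ^ 2 / (p * q)\<close> cancel, leaving the overlap error
  and the two corrections from the inexact centering.\<close>

lemma integral_dev_mult_le:
  assumes "prime p" "prime q" "p < q" "0 \<le> c" "c \<le> 1 / 2"
  shows "(\<integral>w. dev c p w * dev c q w \<partial>joint) \<le> 3 / (real q)\<^sup>2 + 1 / real q * (1 / (real p)\<^sup>2)"
proof -
  have pq: "real p \<ge> 1" "real q \<ge> 1" using assms prime_ge_1_nat by auto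
  have c2: "2 * c\<^sup>2 \<le> 1" using power_mono[OF assms(5,4), of 2] by (simp add: power2_eq_square)
  have "4 * c / (real q)\<^sup>2 \<le> 2 / (real q)\<^sup>2" using assms by (intro divide_right_mono) auto
  moreover have "2 * c\<^sup>2 / (real q * (real p)\<^sup>2) \<le> 1 / (real q * (real p)\<^sup>2)"
    using c2 by (intro divide_right_mono) auto
  moreover have "2 * c\<^sup>2 / (real p * (real q)\<^sup>2) \<le> 1 / (real q)\<^sup>2"
    using c2 pq by (intro frac_le) auto
  ultimately show ?thesis
    using measure_hit_Int_le[OF assms] unfolding integral_dev_mult[OF assms(1,2,4,5)] by simp
qed

text \<open>For fixed \<open>q\<close>, the covariances with smaller primes sum to at most
  \<open>4 / q\<close>. Counting both orders gives \<open>8 / q\<close>, and the diagonal adds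
  \<open>1 / q\<close>, hence the constant 9.\<close>

lemma second_moment_dev:
  assumes "finite B" "\<And>p. p \<in> B \<Longrightarrow> prime p" "0 \<le> c" "c \<le> 1 / 2"
  shows "(\<integral>\<^sup>+w. ennreal ((\<Sum>p\<in>B. dev c p w)\<^sup>2) \<partial>joint) \<le> ennreal (9 * (\<Sum>p\<in>B. 1 / real p))"
proof -
  define h where "h p q = (if p < q then 3 / (real q)\<^sup>2 + 1 / real q * (1 / (real p)\<^sup>2) else 0)"
    for p q :: nat
  have le: "(\<integral>w. dev c p w * dev c q w \<partial>joint) \<le> h p q + h q p + (if p = q then 1 / real q else 0)"
    if "p \<in> B" "q \<in> B" for p q
  proof (cases p q rule: linorder_cases)
    case less
    then show ?thesis using integral_dev_mult_le[of p q c] assms that by (simp add: h_def)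
  next
    case equal
    then show ?thesis using integral_dev_square_le[of p c] assms that by (simp add: h_def)
  next
    case greater
    then show ?thesis using integral_dev_mult_le[of q p c] assms that by (simp add: h_def mult.commute)
  qed
  have col: "(\<Sum>p\<in>B. h p q) \<le> 4 * (1 / real q)" if "q \<in> B" for q
  proof -
    have q: "real q > 0" using assms(2)[OF that] prime_gt_0_nat by auto
    have "(\<Sum>p\<in>B. h p q) \<le> (\<Sum>p\<in>B. (if p < q then 3 / (real q)\<^sup>2 else 0) + 1 / real q * (1 / (real p)\<^sup>2))"
      by (intro sum_mono) (auto simp: h_def)
    also have "\<dots> = (\<Sum>p\<in>B \<inter> {..<q}. 3 / (real q)\<^sup>2) + 1 / real q * (\<Sum>p\<in>B. 1 / (real p)\<^sup>2)"
      using assms(1) by (simp only: sum.distrib sum_distrib_left sum.inter_restrict lessThan_iff)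
    \<comment> \<open>At most \<open>q\<close> terms equal \<open>3 / q ^ 2\<close>, and the inverse
      squares sum to at most 1.\<close>
    also have "\<dots> \<le> (\<Sum>p\<in>{..<q}. 3 / (real q)\<^sup>2) + 1 / real q * 1"
      using assms(1,2) q
      by (intro add_mono mult_left_mono sum_mono2 sum_inverse_squares_le) (auto dest: prime_ge_2_nat)
    also have "\<dots> = 4 * (1 / real q)" using q by (simp add: power2_eq_square)
    finally show ?thesis .
  qed
  have sq: "(\<Sum>p\<in>B. dev c p w)\<^sup>2 = (\<Sum>p\<in>B. \<Sum>q\<in>B. dev c p w * dev c q w)" for w
    by (simp add: power2_eq_square sum_product)
  have int: "integrable joint (\<lambda>w. (\<Sum>p\<in>B. dev c p w)\<^sup>2)"
    unfolding sq using assms by (intro Bochner_Integration.integrable_sum integrable_dev_mult) auto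
  have "(\<integral>w. (\<Sum>p\<in>B. dev c p w)\<^sup>2 \<partial>joint) = (\<Sum>p\<in>B. \<Sum>q\<in>B. \<integral>w. dev c p w * dev c q w \<partial>joint)"
    unfolding sq using assms
    by (subst Bochner_Integration.integral_sum; intro sum.cong refl Bochner_Integration.integrable_sum
        Bochner_Integration.integral_sum integrable_dev_mult) auto
  also have "\<dots> \<le> (\<Sum>p\<in>B. \<Sum>q\<in>B. h p q + h q p + (if p = q then 1 / real q else 0))"
    by (intro sum_mono le)
  also have "\<dots> = 2 * (\<Sum>q\<in>B. \<Sum>p\<in>B. h p q) + (\<Sum>p\<in>B. 1 / real p)"
    using assms(1) sum.swap[of h B B] by (simp add: sum.distrib)
  also have "\<dots> \<le> 2 * (\<Sum>q\<in>B. 4 * (1 / real q)) + (\<Sum>p\<in>B. 1 / real p)"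
    by (intro add_mono mult_left_mono sum_mono col) auto
  also have "\<dots> = 9 * (\<Sum>p\<in>B. 1 / real p)"
    unfolding sum_distrib_left[symmetric] by simp
  finally show ?thesis by (subst nn_integral_eq_integral[OF int]) (auto intro: ennreal_leI)
qed

section \<open>Almost sure counting\<close>

text \<open>By monotonicity \<open>N X\<close> lies between its values at consecutive points
  \<open>exp (exp j)\<close>, and between these the main term changes only by
  \<open>\<kappa>\<close>.\<close>

lemma powr_bound_of_exp_exp_bound:
  fixes N :: "real \<Rightarrow> real"
  assumes "mono N" "B \<ge> 0" "\<kappa> \<ge> 0" "\<alpha> \<ge> 0"
    and bound: "\<And>j. \<bar>N (exp (exp (real j))) - \<kappa> * real j\<bar> \<le> B * (real j + 1) powr \<alpha>"
  shows "\<exists>C. \<forall>X\<ge>3. \<bar>N X - \<kappa> * ln (ln X)\<bar> \<le> C * ln (ln X) powr \<alpha>"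
proof -
  \<comment> \<open>\<open>X \<ge> 3\<close> keeps \<open>ln (ln X)\<close> above the positive
    number \<open>l\<close>, which lets additive constants be absorbed into a multiple of
    it.\<close>
  define l where "l = ln (ln (3::real))"
  have l: "l > 0" unfolding l_def using ln3_gt_1 by simp
  have "\<bar>N X - \<kappa> * ln (ln X)\<bar> \<le> ((\<kappa> + B) * (1 + 2 / l) powr \<alpha>) * ln (ln X) powr \<alpha>" if "X \<ge> 3" for X
  proof -
    define L where "L = ln (ln X)"
    have lnX: "ln X \<ge> ln 3" using that by simp
    then have L: "L \<ge> l" unfolding L_def l_def using ln3_gt_1 by (subst ln_le_cancel_iff) auto
    have X: "X = exp (exp L)" unfolding L_def using that lnX ln3_gt_1 by simp
    define j where "j = nat \<lfloor>L\<rfloor>"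
    have j: "real j \<le> L" "L \<le> real (Suc j)" unfolding j_def using L l by linarith+
    have "N (exp (exp (real j))) \<le> N X" "N X \<le> N (exp (exp (real (Suc j))))"
      unfolding X using j by (auto intro!: monoD[OF \<open>mono N\<close>])
    moreover have "B * (real j + 1) powr \<alpha> \<le> B * (real j + 2) powr \<alpha>"
      using assms by (intro mult_left_mono powr_mono2) auto
    moreover have "B * (real (Suc j) + 1) powr \<alpha> = B * (real j + 2) powr \<alpha>" by (simp add: add.commute)
    moreover have "\<kappa> * real j \<le> \<kappa> * L" "\<kappa> * L \<le> \<kappa> * real (Suc j)"
      using j assms by (auto intro: mult_left_mono simp del: of_nat_Suc)
    moreover have "\<kappa> * real (Suc j) = \<kappa> * real j + \<kappa>" by (simp add: algebra_simps)
    ultimately have "\<bar>N X - \<kappa> * L\<bar> \<le> \<kappa> + B * (real j + 2) powr \<alpha>"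
      using bound[of j] bound[of "Suc j"] by linarith
    also have "\<dots> \<le> \<kappa> * (real j + 2) powr \<alpha> + B * (real j + 2) powr \<alpha>"
      using assms ge_one_powr_ge_zero[of "real j + 2" \<alpha>]
      by (intro add_mono mult_left_mono[of 1 _ \<kappa>, simplified]) auto
    also have "\<dots> = (\<kappa> + B) * (real j + 2) powr \<alpha>" by (simp add: algebra_simps)
    also have "\<dots> \<le> (\<kappa> + B) * ((1 + 2 / l) * L) powr \<alpha>"
    proof (intro mult_left_mono powr_mono2)
      have "2 \<le> 2 / l * L" using L l by (simp add: field_simps)
      then show "real j + 2 \<le> (1 + 2 / l) * L" using j by (simp add: algebra_simps)
    qed (use assms in auto)
    also have "\<dots> = ((\<kappa> + B) * (1 + 2 / l) powr \<alpha>) * L powr \<alpha>"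
      using L l by (simp add: powr_mult)
    finally show ?thesis unfolding L_def .
  qed
  then show ?thesis by blast
qed

definition count_hits :: "real \<Rightarrow> (nat \<Rightarrow> int) \<Rightarrow> real \<Rightarrow> real \<Rightarrow> real" where
  "count_hits c a x X = real (card {p::nat. prime p \<and> real p \<le> X \<and>
                \<bar>x - real_of_int (a p) / real p\<bar> \<le> c / real p})"

lemma finite_primes_le: "finite {p::nat. prime p \<and> real p \<le> X}"
proof (rule finite_subset)
  show "{p::nat. prime p \<and> real p \<le> X} \<subseteq> {..nat \<lfloor>X\<rfloor>}" by (auto simp: le_nat_floor)
qed simp

lemma mono_count_hits: "mono (count_hits c a x)"
  unfolding count_hits_def
  by (intro monoI of_nat_mono card_mono finite_subset[OF _ finite_primes_le]) auto

lemma sum_dev_eq: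
  assumes "(a, x) \<in> space joint"
  shows "(\<Sum>p | prime p \<and> real p \<le> X. dev c p (a, x)) =
    count_hits c a x X - 2 * c * (\<Sum>p | prime p \<and> real p \<le> X. 1 / real p)"
proof -
  have "(\<Sum>p | prime p \<and> real p \<le> X. indicator (hit c p) (a, x)) =
      (\<Sum>p | prime p \<and> real p \<le> X. if \<bar>x - real_of_int (a p) / real p\<bar> \<le> c / real p then 1 else 0 :: real)"
    using assms by (intro sum.cong refl) (auto simp: hit_def)
  also have "\<dots> = count_hits c a x X"
    using finite_primes_le by (simp add: count_hits_def sum.If_cases Int_def conj_assoc)
  finally show ?thesis
    by (simp add: dev_def sum_subtractf sum_distrib_left)
qed

text \<open>The exceptional null set comes from \<open>AE_dyadic_bound\<close>, where
  \<open>\<epsilon>\<close> does not occur, so one null set serves all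
  \<open>\<epsilon>\<close>.\<close>

lemma AE_count_hits:
  assumes "0 < c" "c \<le> 1 / 2"
  shows "AE w in joint. \<forall>\<epsilon>>0. \<exists>C. \<forall>X\<ge>3.
    \<bar>count_hits c (fst w) (snd w) X - 2 * c * ln (ln X)\<bar> \<le> C * ln (ln X) powr (1 / 2 + \<epsilon>)"
proof -
  define P where "P X = {p::nat. prime p \<and> real p \<le> X}" for X :: real
  have finP: "finite (P X)" for X unfolding P_def by (rule finite_primes_le)
  have P_prime: "prime p" if "p \<in> P X" for p X using that by (simp add: P_def)
  define t where "t j = exp (exp (real j))" for j
  obtain C where C: "\<And>x. x \<ge> 2 \<Longrightarrow> \<bar>(\<Sum>p\<in>P x. 1 / real p) - ln (ln x)\<bar> \<le> C"
    unfolding P_def by (rule mertens_second) blast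
  have t2: "t j \<ge> 2" for j
  proof -
    have "1 \<le> exp (real j)" by simp
    then show ?thesis unfolding t_def using exp_ge_add_one_self[of "exp (real j)"] by linarith
  qed
  have Ct: "\<bar>(\<Sum>p\<in>P (t j). 1 / real p) - real j\<bar> \<le> C" for j
    using C[OF t2[of j]] by (simp add: t_def)
  have "C \<ge> 0" using Ct[of 0] by linarith
  define F where "F j w = (\<Sum>p\<in>P (t j). dev c p w)" for j w
  have meas: "F j \<in> borel_measurable joint" for j
    unfolding F_def using P_prime by (intro borel_measurable_sum borel_measurable_dev) auto
  have mom: "(\<integral>\<^sup>+w. ennreal ((F j w - F i w)\<^sup>2) \<partial>joint) \<le> ennreal (9 * (1 + 2 * C) * real (j - i))"
    if "i \<le> j" for i j
  \<comment> \<open>For \<open>i < j\<close> Mertens bounds the block sum by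
    \<open>j - i + 2 * C\<close>, and \<open>j - i \<ge> 1\<close> absorbs the constant; for
    \<open>i = j\<close> the increment is zero.\<close>
  proof (cases "i = j")
    case False
    have "t i \<le> t j" unfolding t_def using that by simp
    then have sub: "P (t i) \<subseteq> P (t j)" unfolding P_def by auto
    have diff: "(\<Sum>p\<in>P (t j) - P (t i). f p) = (\<Sum>p\<in>P (t j). f p) - (\<Sum>p\<in>P (t i). f p)"
      for f :: "nat \<Rightarrow> real"
      using finP sub by (intro sum_diff) auto
    have "(\<integral>\<^sup>+w. ennreal ((F j w - F i w)\<^sup>2) \<partial>joint) \<le> ennreal (9 * (\<Sum>p\<in>P (t j) - P (t i). 1 / real p))"
      unfolding F_def diff[symmetric] using assms finP P_prime by (intro second_moment_dev) auto
    also have "\<dots> \<le> ennreal (9 * (1 + 2 * C) * real (j - i))"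
    proof (rule ennreal_leI)
      have ji: "real (j - i) = real j - real i" "real (j - i) \<ge> 1" using that False by auto
      have "(\<Sum>p\<in>P (t j) - P (t i). 1 / real p) \<le> real (j - i) + 2 * C * 1"
        unfolding diff ji(1) using Ct[of i] Ct[of j] by linarith
      also have "\<dots> \<le> real (j - i) + 2 * C * real (j - i)"
        using ji(2) \<open>C \<ge> 0\<close> by (intro add_left_mono mult_left_mono) auto
      finally show "9 * (\<Sum>p\<in>P (t j) - P (t i). 1 / real p) \<le> 9 * (1 + 2 * C) * real (j - i)"
        by (simp add: algebra_simps)
    qed
    finally show ?thesis .
  qed simp
  have "AE w in joint. \<exists>C\<ge>0. \<forall>r. \<forall>j<2 ^ r. (F j w - F 0 w)\<^sup>2 \<le> C * (real r + 1) ^ 4 * 2 ^ r"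
    using meas mom \<open>C \<ge> 0\<close> by (intro AE_dyadic_bound[where K = "9 * (1 + 2 * C)"]) auto
  then show ?thesis
  proof (rule AE_mp, intro AE_I2 impI allI)
    fix w and \<epsilon> :: real
    assume w: "w \<in> space joint" and "\<epsilon> > 0"
      and "\<exists>C\<ge>0. \<forall>r. \<forall>j<2 ^ r. (F j w - F 0 w)\<^sup>2 \<le> C * (real r + 1) ^ 4 * 2 ^ r"
    then obtain C' where C': "C' \<ge> 0" "\<And>r j. j < 2 ^ r \<Longrightarrow> (F j w - F 0 w)\<^sup>2 \<le> C' * (real r + 1) ^ 4 * 2 ^ r"
      by blast
    obtain B where B: "B \<ge> 0" "\<And>j. j \<ge> 1 \<Longrightarrow> \<bar>F j w - F 0 w\<bar> \<le> B * real j powr (1 / 2 + \<epsilon>)"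
      using dyadic_bound_imp_powr_bound[of "\<lambda>j. F j w - F 0 w", OF C'(2) C'(1) \<open>\<epsilon> > 0\<close>] by auto
    \<comment> \<open>The three parts are the starting value, the chaining bound, and the Mertens
      error times \<open>2 * c\<close>.\<close>
    let ?B = "\<bar>F 0 w\<bar> + B + 2 * c * C"
    show "\<exists>C. \<forall>X\<ge>3. \<bar>count_hits c (fst w) (snd w) X - 2 * c * ln (ln X)\<bar> \<le> C * ln (ln X) powr (1 / 2 + \<epsilon>)"
    proof (rule powr_bound_of_exp_exp_bound[where B = ?B, OF mono_count_hits])
      fix j
      have "\<bar>F j w - F 0 w\<bar> \<le> B * (real j + 1) powr (1 / 2 + \<epsilon>)"
      proof (cases "j = 0")
        case False
        then have "\<bar>F j w - F 0 w\<bar> \<le> B * real j powr (1 / 2 + \<epsilon>)" by (intro B(2)) simp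
        also have "\<dots> \<le> B * (real j + 1) powr (1 / 2 + \<epsilon>)"
          using B(1) \<open>\<epsilon> > 0\<close> by (intro mult_left_mono powr_mono2) auto
        finally show ?thesis .
      qed (use B(1) in simp)
      moreover have "\<bar>F 0 w\<bar> + 2 * c * C \<le> (\<bar>F 0 w\<bar> + 2 * c * C) * (real j + 1) powr (1 / 2 + \<epsilon>)"
        using assms \<open>C \<ge> 0\<close> \<open>\<epsilon> > 0\<close> ge_one_powr_ge_zero[of "real j + 1" "1 / 2 + \<epsilon>"]
        by (intro mult_left_mono[of 1 _ "\<bar>F 0 w\<bar> + 2 * c * C", simplified]) auto
      moreover have "F j w = count_hits c (fst w) (snd w) (t j) - 2 * c * (\<Sum>p\<in>P (t j). 1 / real p)"
        using sum_dev_eq[of "fst w" "snd w"] w unfolding F_def P_def by simp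
      moreover have "2 * c * \<bar>(\<Sum>p\<in>P (t j). 1 / real p) - real j\<bar> \<le> 2 * c * C"
        using Ct assms by (intro mult_left_mono) auto
      then have "\<bar>2 * c * (\<Sum>p\<in>P (t j). 1 / real p) - 2 * c * real j\<bar> \<le> 2 * c * C"
        using assms by (simp add: abs_mult flip: right_diff_distrib)
      moreover have "?B * (real j + 1) powr (1 / 2 + \<epsilon>) = B * (real j + 1) powr (1 / 2 + \<epsilon>)
          + (\<bar>F 0 w\<bar> + 2 * c * C) * (real j + 1) powr (1 / 2 + \<epsilon>)" by (simp add: algebra_simps)
      ultimately show "\<bar>count_hits c (fst w) (snd w) (exp (exp (real j))) - 2 * c * real j\<bar>
          \<le> ?B * (real j + 1) powr (1 / 2 + \<epsilon>)"
        unfolding t_def[symmetric] by linarith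
    next
      show "0 \<le> ?B" using assms B(1) \<open>C \<ge> 0\<close> by (intro add_nonneg_nonneg) auto
    qed (use assms \<open>\<epsilon> > 0\<close> in simp_all)
  qed
qed

lemma AE_AE_count_hits:
  assumes "0 < c" "c \<le> 1 / 2"
  shows "AE a in Omega. AE x in lambda01. \<forall>\<epsilon>>0. \<exists>C. \<forall>X\<ge>3.
    \<bar>count_hits c a x X - 2 * c * ln (ln X)\<bar> \<le> C * ln (ln X) powr (1 / 2 + \<epsilon>)"
  using J.AE_pair[OF AE_count_hits[OF assms]] by simp

section \<open>Infinitely many hits, \<open>calA\<close>, and sets of full measure\<close>

text \<open>The exponent \<open>3 / 4\<close> is below 1, so the main term dominates the error and
  the count is unbounded.\<close>

lemma infinite_hits:
  assumes "0 < c" and bound: "\<And>X. X \<ge> 3 \<Longrightarrow> \<bar>count_hits c a x X - 2 * c * ln (ln X)\<bar> \<le> C * ln (ln X) powr (3 / 4)"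
  shows "infinite {p. prime p \<and> \<bar>x - real_of_int (a p) / real p\<bar> \<le> c / real p}" (is "infinite ?T")
proof
  assume fin: "finite ?T"
  have "filterlim (\<lambda>X. 2 * c * ln (ln X) - C * ln (ln X) powr (3 / 4)) at_top at_top"
    using \<open>0 < c\<close> by real_asymp
  then have "eventually (\<lambda>X. 2 * c * ln (ln X) - C * ln (ln X) powr (3 / 4) > real (card ?T)) at_top"
    by (simp add: filterlim_at_top_dense)
  then have "eventually (\<lambda>X. 2 * c * ln (ln X) - C * ln (ln X) powr (3 / 4) > real (card ?T) \<and> X \<ge> 3) at_top"
    using eventually_ge_at_top by (rule eventually_conj)
  then obtain X where X: "2 * c * ln (ln X) - C * ln (ln X) powr (3 / 4) > real (card ?T)" "X \<ge> 3"
    by (auto simp: eventually_at_top_linorder)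
  have "count_hits c a x X \<le> real (card ?T)"
    unfolding count_hits_def using fin by (intro of_nat_mono card_mono) auto
  with bound[OF X(2)] X(1) show False by linarith
qed

lemma mem_calA:
  assumes "x \<in> {0..1}"
    and inf: "\<And>k. infinite {p. prime p \<and> \<bar>x - real_of_int (a p) / real p\<bar> \<le> 1 / (2 * (real k + 1)) / real p}"
  shows "x \<in> calA a"
proof -
  let ?f = "\<lambda>p. ereal (real p * \<bar>x - real_of_int (a p) / real p\<bar>)"
  have "0 \<le> Liminf primes_at_top ?f"
    by (rule Liminf_bounded) simp
  moreover have "\<not> 0 < Liminf primes_at_top ?f"
  proof
    assume "0 < Liminf primes_at_top ?f"
    then obtain y where y: "0 < y" "ereal y < Liminf primes_at_top ?f"
      using ereal_dense2[of 0 "Liminf primes_at_top ?f"] by (auto simp: zero_ereal_def)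
    \<comment> \<open>The radii \<open>1 / (2 * (k + 1))\<close> tend to 0, so one of them is at
      most the supposed lower bound \<open>y\<close>.\<close>
    obtain k where "1 / y < real k" using reals_Archimedean2 by blast
    then have k: "1 / (2 * (real k + 1)) \<le> y" using y(1) by (simp add: field_simps)
    have "eventually (\<lambda>p. ereal y < ?f p) primes_at_top"
      using y(2) le_Liminf_iff[of "Liminf primes_at_top ?f" primes_at_top ?f] by blast
    then obtain n where n: "\<And>p. p \<ge> n \<Longrightarrow> prime p \<Longrightarrow> y < real p * \<bar>x - real_of_int (a p) / real p\<bar>"
      by (auto simp: primes_at_top_def eventually_inf_principal eventually_at_top_linorder)
    obtain p where p: "p \<ge> n" "prime p" "\<bar>x - real_of_int (a p) / real p\<bar> \<le> 1 / (2 * (real k + 1)) / real p"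
      using inf[of k] unfolding infinite_nat_iff_unbounded_le by blast
    have "real p * \<bar>x - real_of_int (a p) / real p\<bar> \<le> 1 / (2 * (real k + 1))"
      using mult_left_mono[OF p(3), of "real p"] prime_gt_0_nat[OF p(2)] by simp
    with n[OF p(1,2)] k show False by linarith
  qed
  ultimately show ?thesis using assms(1) unfolding calA_def by auto
qed

text \<open>Measurability of \<open>A\<close> is derived from completeness of Lebesgue measure: its
  complement in the unit interval lies in a null set. This matters because \<open>emeasure\<close>
  is 0 on non-measurable sets.\<close>

lemma emeasure_AE_1:
  assumes "AE x in lambda01. x \<in> A" "A \<subseteq> {0..1}"
  shows "emeasure lambda01 A = 1"
proof -
  obtain N where N: "N \<in> null_sets lambda01" "{x \<in> space lambda01. x \<notin> A} \<subseteq> N"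
    using assms(1) by (auto simp: eventually_ae_filter)
  have "N \<in> null_sets lebesgue" using N(1) by (simp add: null_sets_restrict_space)
  moreover have "{0..1} - A \<subseteq> N" using N(2) by auto
  ultimately have "{0..1} - A \<in> null_sets lebesgue" by (rule completion.complete2[rotated])
  then have "{0..1} - A \<in> null_sets lambda01"
    by (simp add: null_sets_restrict_space)
  then have "emeasure lambda01 (space lambda01 - ({0..1} - A)) = emeasure lambda01 (space lambda01)"
    by (intro emeasure_Diff_null_set) auto
  moreover have "space lambda01 - ({0..1} - A) = A" using assms(2) by auto
  ultimately show ?thesis using J.M2.emeasure_space_1 by simp
qed

theorem theorem1p1:
  shows "(AE a in Omega. emeasure lambda01 (calA a) = 1) \<and>
    (\<forall>c::real. 0 < c \<and> c \<le> 1 / 2 \<longrightarrow>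
      (AE a in Omega. \<exists>S. S \<subseteq> {0..1} \<and> emeasure lambda01 S = 1 \<and>
        (\<forall>x\<in>S. \<forall>\<epsilon>::real. \<epsilon> > 0 \<longrightarrow> (\<exists>C::real. \<forall>X::real. X \<ge> 3 \<longrightarrow>
          \<bar>real (card {p::nat. prime p \<and> real p \<le> X \<and>
                \<bar>x - real_of_int (a p) / real p\<bar> \<le> c / real p}) - 2 * c * ln (ln X)\<bar>
            \<le> C * (ln (ln X)) powr (1 / 2 + \<epsilon>)))))"
proof (intro conjI allI impI)
  \<comment> \<open>Countably many radii suffice, and a countable union of null sets is null;
    \<open>k = 0\<close> gives the largest admissible radius \<open>1 / 2\<close>.\<close>
  have "AE a in Omega. \<forall>k::nat. AE x in lambda01. \<forall>\<epsilon>>0. \<exists>C. \<forall>X\<ge>3.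
    \<bar>count_hits (1 / (2 * (real k + 1))) a x X - 2 * (1 / (2 * (real k + 1))) * ln (ln X)\<bar>
      \<le> C * ln (ln X) powr (1 / 2 + \<epsilon>)"
    unfolding AE_all_countable by (intro allI AE_AE_count_hits) (auto simp: field_simps)
  then show "AE a in Omega. emeasure lambda01 (calA a) = 1"
  proof (rule AE_mp, intro AE_I2 impI)
    fix a assume "\<forall>k::nat. AE x in lambda01. \<forall>\<epsilon>>0. \<exists>C. \<forall>X\<ge>3.
      \<bar>count_hits (1 / (2 * (real k + 1))) a x X - 2 * (1 / (2 * (real k + 1))) * ln (ln X)\<bar>
        \<le> C * ln (ln X) powr (1 / 2 + \<epsilon>)"
    then have "AE x in lambda01. \<forall>k::nat. \<forall>\<epsilon>>0. \<exists>C. \<forall>X\<ge>3.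
      \<bar>count_hits (1 / (2 * (real k + 1))) a x X - 2 * (1 / (2 * (real k + 1))) * ln (ln X)\<bar>
        \<le> C * ln (ln X) powr (1 / 2 + \<epsilon>)"
      unfolding AE_all_countable .
    then have "AE x in lambda01. x \<in> calA a"
    proof (rule AE_mp, intro AE_I2 impI)
      fix x assume x: "x \<in> space lambda01" and *: "\<forall>k::nat. \<forall>\<epsilon>>0. \<exists>C. \<forall>X\<ge>3.
        \<bar>count_hits (1 / (2 * (real k + 1))) a x X - 2 * (1 / (2 * (real k + 1))) * ln (ln X)\<bar>
          \<le> C * ln (ln X) powr (1 / 2 + \<epsilon>)"
      show "x \<in> calA a"
      proof (rule mem_calA)
        show "x \<in> {0..1}" using x by simp
        fix k :: nat
        obtain C where "\<forall>X\<ge>3. \<bar>count_hits (1 / (2 * (real k + 1))) a x X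
            - 2 * (1 / (2 * (real k + 1))) * ln (ln X)\<bar> \<le> C * ln (ln X) powr (1 / 2 + 1 / 4)"
          using *[rule_format, of "1 / 4" k] by auto
        then show "infinite {p. prime p \<and> \<bar>x - real_of_int (a p) / real p\<bar> \<le> 1 / (2 * (real k + 1)) / real p}"
          by (intro infinite_hits[where C = C]) auto
      qed
    qed
    then show "emeasure lambda01 (calA a) = 1"
      by (rule emeasure_AE_1) (auto simp: calA_def)
  qed
next
  fix c :: real assume "0 < c \<and> c \<le> 1 / 2"
  then have "AE a in Omega. AE x in lambda01. \<forall>\<epsilon>>0. \<exists>C. \<forall>X\<ge>3.
    \<bar>count_hits c a x X - 2 * c * ln (ln X)\<bar> \<le> C * ln (ln X) powr (1 / 2 + \<epsilon>)"
    by (intro AE_AE_count_hits) auto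
  then show "AE a in Omega. \<exists>S. S \<subseteq> {0..1} \<and> emeasure lambda01 S = 1 \<and>
        (\<forall>x\<in>S. \<forall>\<epsilon>::real. \<epsilon> > 0 \<longrightarrow> (\<exists>C::real. \<forall>X::real. X \<ge> 3 \<longrightarrow>
          \<bar>real (card {p::nat. prime p \<and> real p \<le> X \<and>
                \<bar>x - real_of_int (a p) / real p\<bar> \<le> c / real p}) - 2 * c * ln (ln X)\<bar>
            \<le> C * (ln (ln X)) powr (1 / 2 + \<epsilon>)))"
  proof (rule AE_mp, intro AE_I2 impI)
    fix a assume ae: "AE x in lambda01. \<forall>\<epsilon>>0. \<exists>C. \<forall>X\<ge>3.
      \<bar>count_hits c a x X - 2 * c * ln (ln X)\<bar> \<le> C * ln (ln X) powr (1 / 2 + \<epsilon>)"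
    \<comment> \<open>\<open>S\<close> consists of all points with the required bound; its
      measurability is supplied by \<open>emeasure_AE_1\<close>.\<close>
    define S where "S = {x \<in> {0..1}. \<forall>\<epsilon>>0. \<exists>C. \<forall>X\<ge>3.
      \<bar>count_hits c a x X - 2 * c * ln (ln X)\<bar> \<le> C * ln (ln X) powr (1 / 2 + \<epsilon>)}"
    have "AE x in lambda01. x \<in> S"
      using ae by (rule AE_mp) (auto simp: S_def intro!: AE_I2)
    then have "emeasure lambda01 S = 1" by (rule emeasure_AE_1) (auto simp: S_def)
    then show "\<exists>S. S \<subseteq> {0..1} \<and> emeasure lambda01 S = 1 \<and>
        (\<forall>x\<in>S. \<forall>\<epsilon>::real. \<epsilon> > 0 \<longrightarrow> (\<exists>C::real. \<forall>X::real. X \<ge> 3 \<longrightarrow>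
          \<bar>real (card {p::nat. prime p \<and> real p \<le> X \<and>
                \<bar>x - real_of_int (a p) / real p\<bar> \<le> c / real p}) - 2 * c * ln (ln X)\<bar>
            \<le> C * (ln (ln X)) powr (1 / 2 + \<epsilon>)))"
      unfolding count_hits_def[symmetric] by (intro exI[of _ S]) (auto simp: S_def)
  qed
qed

end
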